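(* Let $b>0$ be a constant and let $M_2(b)$ be a non-planar regular rotational surface with zero mean curvature in $\mathbb{E}^4_2$ parametrized by $r_2(s,t)=(x(s)\cos t,\ x(s)\sin t,\ z(s)\cos(bt),\ z(s)\sin(bt))$, with profile curve $\beta(s)=(x(s),0,z(s),0)$. Then: (i) If $b=1$ and the components of the profile curve $\beta$ satisfy $$(x(s)+z(s))^2+\lambda_0(x(s)-z(s))^2=\mu_0$$ for some constants $\lambda_0\neq0$ and $\mu_0$, then the surface $M_2(1)$ has pointwise 1-type Gauss map of the second kind. (ii) If $b\neq1$ and $M_2(b)$ is spacelike, then $M_2(b)$ has pointwise 1-type Gauss map of the second kind if and only if the profile curve $\beta$ is given by $z(s)=\bar b_0|x(s)|^{b}$ or $z(s)=\bar b_0|x(s)|^{-b}$ for some constant $\bar b_0\neq0$.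
   Context: $\mathbb{E}^4_2$ is $\mathbb{R}^4$ with the metric $g=dx_1^2+dx_2^2-dx_3^2-dx_4^2$, and $\langle\cdot,\cdot\rangle$ is the associated indefinite inner product. The rotational surface $M_2(b)$: $x,z$ are smooth functions on an open interval $I\subset\mathbb{R}$, $s\in I$, $t\in(0,2\pi)$. Regularity means $x'(s)^2-z'(s)^2\neq0$ and $x(s)^2-b^2z(s)^2\neq0$ for all $s\in I$, so that the induced metric is nondegenerate. Spacelike means that the induced metric is positive definite. Non-planar means not an open part of a 2-plane. Let $\{e_1,e_2,e_3,e_4\}$ be an oriented local orthonormal frame with $e_1,e_2$ tangent and $e_3,e_4$ normal to the surface $M$, $\varepsilon_A=\langle e_A,e_A\rangle=\pm1$. The mean curvature vector is $H=\frac12\sum_{i=1}^2\varepsilon_i h(e_i,e_i)$, where $h$ is the second fundamental form; zero mean curvature means $H\equiv0$. The Gauss map is $\nu=e_3\wedge e_4$, viewed as a map $M\to\Lambda^2\mathbb{E}^4_2\cong\mathbb{E}^6_s$ (pseudo-Euclidean space for the inner product induced on $\Lambda^2$ by determinants). The Laplacian on $M$ is $\Delta=\sum_{i=1}^2\varepsilon_i(\nabla_{e_i}e_i-e_ie_i)$, where $\nabla$ is the Levi-Civita connection of $M$, applied componentwise to vector-valued maps. $M$ has pointwise 1-type Gauss map if $\Delta\nu=f(\nu+C)$ for some smooth function $f$ on $M$ and some constant vector $C\in\Lambda^2\mathbb{E}^4_2$; it is of the first kind if $C=0$, and of the second kind otherwise. *)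

theory Defs
  imports "HOL-Analysis.Analysis"
begin

section \<open>Smooth maps\<close>

primrec diff_order_on ::
  "'a::real_normed_vector set \<Rightarrow> ('a \<Rightarrow> 'b::real_normed_vector) \<Rightarrow> nat \<Rightarrow> bool" where
  "diff_order_on S f 0 \<longleftrightarrow> continuous_on S f"
| "diff_order_on S f (Suc n) \<longleftrightarrow>
     (\<forall>p\<in>S. f differentiable (at p)) \<and>
     (\<forall>v. diff_order_on S (\<lambda>p. frechet_derivative f (at p) v) n)"

text \<open>For open sets in finite-dimensional spaces this is the class of infinitely
  differentiable maps; only open \<^term>\<open>S\<close> are considered.\<close>

definition smooth_on ::
  "'a::real_normed_vector set \<Rightarrow> ('a \<Rightarrow> 'b::real_normed_vector) \<Rightarrow> bool" where
  "smooth_on S f \<longleftrightarrow> (\<forall>n. diff_order_on S f n)"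


section \<open>The pseudo-Euclidean space and its bivectors\<close>

definition ip :: "real ^ 4 \<Rightarrow> real ^ 4 \<Rightarrow> real" where
  "ip u v = u $ 1 * v $ 1 + u $ 2 * v $ 2 - u $ 3 * v $ 3 - u $ 4 * v $ 4"

text \<open>The second exterior power of the 4-space is realised as the 6-dimensional space of
  antisymmetric arrays: the entries with \<open>i < j\<close> are the coordinates with respect to the
  basis of bivectors \<open>\<partial>_i \<and> \<partial>_j\<close>.\<close>

definition bivectors :: "(real ^ 4 ^ 4) set" where
  "bivectors = {A. \<forall>i j. A $ i $ j = - (A $ j $ i)}"

definition wedge :: "real ^ 4 \<Rightarrow> real ^ 4 \<Rightarrow> real ^ 4 ^ 4" where
  "wedge u v = (\<chi> i j. u $ i * v $ j - u $ j * v $ i)"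


section \<open>Parametrized surfaces\<close>

text \<open>A surface is an immersion \<open>r\<close> of an open set \<open>U\<close> of the parameter plane. Functions and
  tangent vector fields on the surface are given on \<open>U\<close>; the tangent vector of the surface
  corresponding to \<open>X p\<close> is the image of \<open>X p\<close> under the differential of \<open>r\<close>, that is,
  \<open>deriv_along X r p\<close>.\<close>

definition deriv_along ::
  "(real \<times> real \<Rightarrow> real \<times> real) \<Rightarrow> (real \<times> real \<Rightarrow> 'a::real_normed_vector) \<Rightarrow> real \<times> real \<Rightarrow> 'a" where
  "deriv_along X F p = frechet_derivative F (at p) (X p)"

definition spacelike :: "(real \<times> real \<Rightarrow> real ^ 4) \<Rightarrow> (real \<times> real) set \<Rightarrow> bool" where
  "spacelike r U \<longleftrightarrow> (\<forall>p\<in>U. \<forall>v. v \<noteq> 0 \<longrightarrow>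
     ip (frechet_derivative r (at p) v) (frechet_derivative r (at p) v) > 0)"

definition planar :: "(real \<times> real \<Rightarrow> real ^ 4) \<Rightarrow> (real \<times> real) set \<Rightarrow> bool" where
  "planar r U \<longleftrightarrow> (\<exists>P. affine P \<and> aff_dim P = 2 \<and> r ` U \<subseteq> P)"

text \<open>An adapted frame consists of \<open>E 1, E 2, E 3, E 4\<close>, of which \<open>E 1\<close> and \<open>E 2\<close> are tangent,
  with parameter-plane representatives \<open>X 1\<close> and \<open>X 2\<close>. As \<open>E 1\<close> and \<open>E 2\<close> then span the tangent
  plane, \<open>E 3\<close> and \<open>E 4\<close> are normal by orthogonality.\<close>

definition adapted_frame ::
  "(real \<times> real \<Rightarrow> real ^ 4) \<Rightarrow> (real \<times> real) set \<Rightarrow>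
   (nat \<Rightarrow> real \<times> real \<Rightarrow> real \<times> real) \<Rightarrow> (nat \<Rightarrow> real \<times> real \<Rightarrow> real ^ 4) \<Rightarrow> bool" where
  "adapted_frame r U X E \<longleftrightarrow>
     (\<forall>i\<in>{1,2}. smooth_on U (X i)) \<and>
     (\<forall>i\<in>{1..4}. smooth_on U (E i)) \<and>
     (\<forall>p\<in>U.
        (\<forall>i\<in>{1,2}. E i p = deriv_along (X i) r p) \<and>
        (\<forall>i\<in>{1..4}. ip (E i p) (E i p) \<in> {1, -1}) \<and>
        (\<forall>i\<in>{1..4}. \<forall>j\<in>{1..4}. i \<noteq> j \<longrightarrow> ip (E i p) (E j p) = 0) \<and>
        det (vector [E 1 p, E 2 p, E 3 p, E 4 p] :: real ^ 4 ^ 4) > 0)"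

definition eps :: "(nat \<Rightarrow> real \<times> real \<Rightarrow> real ^ 4) \<Rightarrow> nat \<Rightarrow> real \<times> real \<Rightarrow> real" where
  "eps E i p = ip (E i p) (E i p)"

text \<open>By the Gauss formula, the derivative in the ambient space of one tangent field along
  another splits into a tangential part, the Levi-Civita derivative of the induced metric, and
  a normal part, the second fundamental form. The tangential part is expanded in the
  orthonormal frame \<open>E 1, E 2\<close> and returned as a field on the parameter plane.\<close>

definition nabla ::
  "(real \<times> real \<Rightarrow> real ^ 4) \<Rightarrow> (nat \<Rightarrow> real \<times> real \<Rightarrow> real \<times> real) \<Rightarrow>
   (nat \<Rightarrow> real \<times> real \<Rightarrow> real ^ 4) \<Rightarrow> (real \<times> real \<Rightarrow> real \<times> real) \<Rightarrow>
   (real \<times> real \<Rightarrow> real \<times> real) \<Rightarrow> real \<times> real \<Rightarrow> real \<times> real" where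
  "nabla r X E Y Z p =
     (\<Sum>i\<in>{1,2}. (eps E i p * ip (deriv_along Y (deriv_along Z r) p) (E i p)) *\<^sub>R X i p)"

definition second_fundamental_form ::
  "(real \<times> real \<Rightarrow> real ^ 4) \<Rightarrow> (nat \<Rightarrow> real \<times> real \<Rightarrow> real \<times> real) \<Rightarrow>
   (nat \<Rightarrow> real \<times> real \<Rightarrow> real ^ 4) \<Rightarrow> (real \<times> real \<Rightarrow> real \<times> real) \<Rightarrow>
   (real \<times> real \<Rightarrow> real \<times> real) \<Rightarrow> real \<times> real \<Rightarrow> real ^ 4" where
  "second_fundamental_form r X E Y Z p =
     deriv_along Y (deriv_along Z r) p - deriv_along (nabla r X E Y Z) r p"

definition mean_curvature_vector ::
  "(real \<times> real \<Rightarrow> real ^ 4) \<Rightarrow> (nat \<Rightarrow> real \<times> real \<Rightarrow> real \<times> real) \<Rightarrow>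
   (nat \<Rightarrow> real \<times> real \<Rightarrow> real ^ 4) \<Rightarrow> real \<times> real \<Rightarrow> real ^ 4" where
  "mean_curvature_vector r X E p =
     (1 / 2) *\<^sub>R (\<Sum>i\<in>{1,2}. eps E i p *\<^sub>R second_fundamental_form r X E (X i) (X i) p)"

definition laplacian ::
  "(real \<times> real \<Rightarrow> real ^ 4) \<Rightarrow> (nat \<Rightarrow> real \<times> real \<Rightarrow> real \<times> real) \<Rightarrow>
   (nat \<Rightarrow> real \<times> real \<Rightarrow> real ^ 4) \<Rightarrow> (real \<times> real \<Rightarrow> 'a::real_normed_vector) \<Rightarrow>
   real \<times> real \<Rightarrow> 'a" where
  "laplacian r X E F p =
     (\<Sum>i\<in>{1,2}. eps E i p *\<^sub>R
        (deriv_along (nabla r X E (X i) (X i)) F p - deriv_along (X i) (deriv_along (X i) F) p))"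

definition gauss_map ::
  "(nat \<Rightarrow> real \<times> real \<Rightarrow> real ^ 4) \<Rightarrow> real \<times> real \<Rightarrow> real ^ 4 ^ 4" where
  "gauss_map E p = wedge (E 3 p) (E 4 p)"

text \<open>Neither the mean curvature vector nor the Laplacian depends on the adapted frame, and on
  a connected \<open>U\<close> the Gauss map does so only up to a global sign, which can be absorbed in
  \<open>C\<close>. The surfaces below are parametrized by a rectangle and have global adapted frames, so
  the existential quantifiers over frames pick a harmless choice.\<close>

definition zero_mean_curvature :: "(real \<times> real \<Rightarrow> real ^ 4) \<Rightarrow> (real \<times> real) set \<Rightarrow> bool" where
  "zero_mean_curvature r U \<longleftrightarrow>
     (\<exists>X E. adapted_frame r U X E \<and> (\<forall>p\<in>U. mean_curvature_vector r X E p = 0))"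

definition pointwise_1_type_with ::
  "(real \<times> real \<Rightarrow> real ^ 4) \<Rightarrow> (real \<times> real) set \<Rightarrow> real ^ 4 ^ 4 \<Rightarrow> bool" where
  "pointwise_1_type_with r U C \<longleftrightarrow>
     (\<exists>X E f. adapted_frame r U X E \<and> smooth_on U f \<and>
        (\<forall>p\<in>U. laplacian r X E (gauss_map E) p = f p *\<^sub>R (gauss_map E p + C)))"

definition pointwise_1_type :: "(real \<times> real \<Rightarrow> real ^ 4) \<Rightarrow> (real \<times> real) set \<Rightarrow> bool" where
  "pointwise_1_type r U \<longleftrightarrow> (\<exists>C\<in>bivectors. pointwise_1_type_with r U C)"

definition first_kind :: "(real \<times> real \<Rightarrow> real ^ 4) \<Rightarrow> (real \<times> real) set \<Rightarrow> bool" where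
  "first_kind r U \<longleftrightarrow> pointwise_1_type_with r U 0"

text \<open>The two kinds exclude each other. In particular a surface whose Gauss map is harmonic,
  for which \<open>f = 0\<close> and \<open>C\<close> is arbitrary, counts as being of the first kind only.\<close>

definition second_kind :: "(real \<times> real \<Rightarrow> real ^ 4) \<Rightarrow> (real \<times> real) set \<Rightarrow> bool" where
  "second_kind r U \<longleftrightarrow> pointwise_1_type r U \<and> \<not> first_kind r U"


section \<open>Rotational surfaces\<close>

definition rot_surface ::
  "real \<Rightarrow> (real \<Rightarrow> real) \<Rightarrow> (real \<Rightarrow> real) \<Rightarrow> real \<times> real \<Rightarrow> real ^ 4" where
  "rot_surface b x z = (\<lambda>(s, t).
     vector [x s * cos t, x s * sin t, z s * cos (b * t), z s * sin (b * t)])"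

definition rot_domain :: "real set \<Rightarrow> (real \<times> real) set" where
  "rot_domain I = I \<times> {0<..<2 * pi}"

text \<open>The two expressions are the diagonal coefficients of the induced metric, whose
  off-diagonal coefficient vanishes.\<close>

definition regular_profile ::
  "real \<Rightarrow> real set \<Rightarrow> (real \<Rightarrow> real) \<Rightarrow> (real \<Rightarrow> real) \<Rightarrow> bool" where
  "regular_profile b I x z \<longleftrightarrow>
     (\<forall>s\<in>I. (deriv x s)\<^sup>2 - (deriv z s)\<^sup>2 \<noteq> 0 \<and> (x s)\<^sup>2 - b\<^sup>2 * (z s)\<^sup>2 \<noteq> 0)"

end

theory Submission
  imports Defs
begin

text \<open>
  The components of the bivectors \<open>\<nu> = \<nu>\<^sup>- + \<nu>\<^sup>+\<close> of the normal planes in the two halves of the second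
  exterior power (anti-self-dual and self-dual) rotate with the frequencies \<open>1 + b\<close> and \<open>1 - b\<close>
  respectively. For zero mean curvature each half is an eigenfunction up to a variable factor:
  \<open>\<Delta>\<nu>\<^sup>- = m\<^sub>- \<nu>\<^sup>-\<close> and \<open>\<Delta>\<nu>\<^sup>+ = m\<^sub>+ \<nu>\<^sup>+\<close>, where \<open>m\<^sub>-\<close> is a nowhere vanishing multiple of \<open>(1 + b)\<^sup>2 (x z' - b z x')\<^sup>2\<close>
  and \<open>m\<^sub>+\<close> one of \<open>(1 - b)\<^sup>2 (x z' + b z x')\<^sup>2\<close>. If one of the factors vanishes, the corresponding half
  is constant and can be absorbed in \<open>C\<close>; this happens for \<open>b = 1\<close>, and for the profiles
  \<open>z = b\<^sub>0 |x|\<^sup>b\<close> and \<open>z = b\<^sub>0 |x|\<^sup>-\<^sup>b\<close>. The expressions \<open>x z' - b z x'\<close> and \<open>x z' + b z x'\<close> are, up to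
  positive factors, solutions of linear first order equations, so each of them vanishes
  identically or nowhere. If neither vanishes and \<open>b \<noteq> 1\<close>, then both halves really rotate, which
  forces \<open>C = 0\<close>.
\<close>

section \<open>Surfaces with orthogonal coordinates\<close>

lemma ip_add_left: "ip (u + v) w = ip u w + ip v w"
  and ip_scaleR_left: "ip (c *\<^sub>R u) w = c * ip u w"
  and ip_add_right: "ip w (u + v) = ip w u + ip w v"
  and ip_scaleR_right: "ip w (c *\<^sub>R u) = c * ip w u"
  and ip_diff_left: "ip (u - v) w = ip u w - ip v w"
  and ip_diff_right: "ip w (u - v) = ip w u - ip w v"
  and ip_minus_left: "ip (- u) w = - ip u w"
  and ip_minus_right: "ip w (- u) = - ip w u"
  and ip_commute: "ip u w = ip w u"
  by (simp_all add: ip_def algebra_simps)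

lemmas ip_linear = ip_add_left ip_scaleR_left ip_add_right ip_scaleR_right
  ip_diff_left ip_diff_right ip_minus_left ip_minus_right

text \<open>The last five arguments are the partial derivatives with respect to \<open>s\<close> and \<open>t\<close>.\<close>

definition second_order_jet ::
  "(real \<times> real) set \<Rightarrow> (real \<times> real \<Rightarrow> 'a::real_normed_vector) \<Rightarrow> (real \<times> real \<Rightarrow> 'a) \<Rightarrow>
   (real \<times> real \<Rightarrow> 'a) \<Rightarrow> (real \<times> real \<Rightarrow> 'a) \<Rightarrow> (real \<times> real \<Rightarrow> 'a) \<Rightarrow> (real \<times> real \<Rightarrow> 'a) \<Rightarrow> bool" where
  "second_order_jet U F Fs Ft Fss Fst Ftt \<longleftrightarrow>
     (\<forall>p\<in>U. (F has_derivative (\<lambda>v. fst v *\<^sub>R Fs p + snd v *\<^sub>R Ft p)) (at p) \<and>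
            (Fs has_derivative (\<lambda>v. fst v *\<^sub>R Fss p + snd v *\<^sub>R Fst p)) (at p) \<and>
            (Ft has_derivative (\<lambda>v. fst v *\<^sub>R Fst p + snd v *\<^sub>R Ftt p)) (at p))"

lemma second_order_jet_add:
  assumes "second_order_jet U F Fs Ft Fss Fst Ftt" and "second_order_jet U H Hs Ht Hss Hst Htt"
  shows "second_order_jet U (\<lambda>p. F p + H p) (\<lambda>p. Fs p + Hs p) (\<lambda>p. Ft p + Ht p)
           (\<lambda>p. Fss p + Hss p) (\<lambda>p. Fst p + Hst p) (\<lambda>p. Ftt p + Htt p)"
proof -
  have *: "((\<lambda>p. A p + B p) has_derivative (\<lambda>v. fst v *\<^sub>R (a + a') + snd v *\<^sub>R (c + c'))) (at p)"
    if "(A has_derivative (\<lambda>v. fst v *\<^sub>R a + snd v *\<^sub>R c)) (at p)"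
      and "(B has_derivative (\<lambda>v. fst v *\<^sub>R a' + snd v *\<^sub>R c')) (at p)"
    for A B :: "real \<times> real \<Rightarrow> 'a" and a a' c c' p
    by (rule has_derivative_eq_rhs[OF has_derivative_add[OF that]]) (simp add: algebra_simps fun_eq_iff)
  show ?thesis
    using assms unfolding second_order_jet_def by (blast intro: *)
qed

lemma second_order_jet_scaleR:
  assumes "second_order_jet U F Fs Ft Fss Fst Ftt"
  shows "second_order_jet U (\<lambda>p. c *\<^sub>R F p) (\<lambda>p. c *\<^sub>R Fs p) (\<lambda>p. c *\<^sub>R Ft p)
           (\<lambda>p. c *\<^sub>R Fss p) (\<lambda>p. c *\<^sub>R Fst p) (\<lambda>p. c *\<^sub>R Ftt p)"
proof -
  have *: "((\<lambda>p. c *\<^sub>R A p) has_derivative (\<lambda>v. fst v *\<^sub>R (c *\<^sub>R a) + snd v *\<^sub>R (c *\<^sub>R a'))) (at p)"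
    if "(A has_derivative (\<lambda>v. fst v *\<^sub>R a + snd v *\<^sub>R a')) (at p)"
    for A :: "real \<times> real \<Rightarrow> 'a" and a a' p
    by (rule has_derivative_eq_rhs[OF has_derivative_scaleR_right[OF that]])
       (simp add: algebra_simps fun_eq_iff)
  show ?thesis
    using assms unfolding second_order_jet_def by (blast intro: *)
qed

lemma second_order_jet_cong:
  assumes "second_order_jet U F Fs Ft Fss Fst Ftt" and "open U" and "\<And>p. p \<in> U \<Longrightarrow> F p = H p"
  shows "second_order_jet U H Fs Ft Fss Fst Ftt"
  using assms unfolding second_order_jet_def
  by (auto intro: has_derivative_transform_within_open[where f = F])

lemma deriv_along_jet:
  assumes "second_order_jet U F Fs Ft Fss Fst Ftt" and "p \<in> U"
  shows "deriv_along X F p = fst (X p) *\<^sub>R Fs p + snd (X p) *\<^sub>R Ft p"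
proof -
  have "(F has_derivative (\<lambda>v. fst v *\<^sub>R Fs p + snd v *\<^sub>R Ft p)) (at p)"
    using assms unfolding second_order_jet_def by blast
  from frechet_derivative_at[OF this] show ?thesis
    unfolding deriv_along_def by metis
qed

text \<open>Product rule for the combination of \<open>Fs\<close> and \<open>Ft\<close> with the
  components of \<open>X\<close>. Differentiating the jet gives the Hessian of \<open>F\<close> in
  direction \<open>X p\<close>, whose two mixed terms are both \<open>Fst\<close>; differentiating
  \<open>X\<close> gives the first order terms with \<open>deriv_along X X p\<close>.\<close>

lemma deriv_along_twice_jet:
  assumes jet: "second_order_jet U F Fs Ft Fss Fst Ftt" and p: "p \<in> U" and U: "open U"
    and X: "X differentiable (at p)"
  shows "deriv_along X (deriv_along X F) p =
    (fst (X p))\<^sup>2 *\<^sub>R Fss p + (2 * fst (X p) * snd (X p)) *\<^sub>R Fst p + (snd (X p))\<^sup>2 *\<^sub>R Ftt p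
    + (fst (deriv_along X X p) *\<^sub>R Fs p + snd (deriv_along X X p) *\<^sub>R Ft p)"
proof -
  have dX: "(X has_derivative frechet_derivative X (at p)) (at p)"
    using X frechet_derivative_works by blast
  have dFs: "(Fs has_derivative (\<lambda>v. fst v *\<^sub>R Fss p + snd v *\<^sub>R Fst p)) (at p)"
   and dFt: "(Ft has_derivative (\<lambda>v. fst v *\<^sub>R Fst p + snd v *\<^sub>R Ftt p)) (at p)"
    using jet p unfolding second_order_jet_def by auto
  have "((\<lambda>q. fst (X q) *\<^sub>R Fs q + snd (X q) *\<^sub>R Ft q) has_derivative
      (\<lambda>v. (fst (X p) *\<^sub>R (fst v *\<^sub>R Fss p + snd v *\<^sub>R Fst p) + fst (frechet_derivative X (at p) v) *\<^sub>R Fs p)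
         + (snd (X p) *\<^sub>R (fst v *\<^sub>R Fst p + snd v *\<^sub>R Ftt p) + snd (frechet_derivative X (at p) v) *\<^sub>R Ft p))) (at p)"
    by (intro has_derivative_add has_derivative_scaleR has_derivative_fst has_derivative_snd dX dFs dFt)
  then have "((deriv_along X F) has_derivative
      (\<lambda>v. (fst (X p) *\<^sub>R (fst v *\<^sub>R Fss p + snd v *\<^sub>R Fst p) + fst (frechet_derivative X (at p) v) *\<^sub>R Fs p)
         + (snd (X p) *\<^sub>R (fst v *\<^sub>R Fst p + snd v *\<^sub>R Ftt p) + snd (frechet_derivative X (at p) v) *\<^sub>R Ft p))) (at p)"
    by (rule has_derivative_transform_within_open[OF _ U p]) (simp add: deriv_along_jet[OF jet])
  from fun_cong[OF frechet_derivative_at[OF this], of "X p"] have "deriv_along X (deriv_along X F) p = 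
     (fst (X p) *\<^sub>R (fst (X p) *\<^sub>R Fss p + snd (X p) *\<^sub>R Fst p) + fst (deriv_along X X p) *\<^sub>R Fs p)
         + (snd (X p) *\<^sub>R (fst (X p) *\<^sub>R Fst p + snd (X p) *\<^sub>R Ftt p) + snd (deriv_along X X p) *\<^sub>R Ft p)"
    unfolding deriv_along_def[of X "deriv_along X F" p] deriv_along_def[of X X p] by (rule sym)
  moreover have "(2 * fst (X p) * snd (X p)) *\<^sub>R Fst p
      = (fst (X p) * snd (X p)) *\<^sub>R Fst p + (fst (X p) * snd (X p)) *\<^sub>R Fst p"
    by (simp only: scaleR_add_left[symmetric] mult_2 distrib_right)
  ultimately show ?thesis
    by (simp only: scaleR_add_right scaleR_scaleR power2_eq_square mult.commute[of "snd (X p)" "fst (X p)"] ac_simps)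
qed

section \<open>Traces over an orthonormal frame, and the Laplacian in orthogonal coordinates\<close>

lemma frame_trace:
  fixes a1 a2 c1 c2 E G e1 e2 :: real
  assumes 1: "a1\<^sup>2 * E + c1\<^sup>2 * G = e1" and 2: "a2\<^sup>2 * E + c2\<^sup>2 * G = e2"
    and 3: "a1 * a2 * E + c1 * c2 * G = 0"
    and e: "e1 \<in> {1, -1}" "e2 \<in> {1, -1}"
  shows "(a1 * c2 - a2 * c1)\<^sup>2 * (E * G) = e1 * e2"
    and "(e1 * a1\<^sup>2 + e2 * a2\<^sup>2) * E = 1" and "(e1 * c1\<^sup>2 + e2 * c2\<^sup>2) * G = 1"
    and "e1 * a1 * c1 + e2 * a2 * c2 = 0"
proof -
  \<comment> \<open>Let P have rows (a1, c1), (a2, c2) and let g = diag(E, G). The hypotheses say P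
    g P^T = diag(e1, e2), a matrix equal to its own inverse, hence P^T diag(e1, e2) P = g^(-1).
    \<open>d\<close> is det P.\<close>
  define d where "d = a1 * c2 - a2 * c1"
  have dd: "d\<^sup>2 * (E * G) = e1 * e2"
    using 3 unfolding 1[symmetric] 2[symmetric] d_def by algebra
  \<comment> \<open>The entries of d g P^T = adj(P) diag(e1, e2).\<close>
  have A1: "a1 * e2 = c2 * G * d" and A2: "a2 * e1 = - c1 * G * d"
    and A3: "c1 * e2 = - a2 * E * d" and A4: "c2 * e1 = a1 * E * d"
    using 3 unfolding 1[symmetric] 2[symmetric] d_def by algebra+
  have ee: "e1 * e1 = 1" "e2 * e2 = 1" using e by auto
  show "(a1 * c2 - a2 * c1)\<^sup>2 * (E * G) = e1 * e2" using dd d_def by simp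
  show "(e1 * a1\<^sup>2 + e2 * a2\<^sup>2) * E = 1" using dd A1 A2 ee unfolding d_def by algebra
  show "(e1 * c1\<^sup>2 + e2 * c2\<^sup>2) * G = 1" using dd A3 A4 ee unfolding d_def by algebra
  show "e1 * a1 * c1 + e2 * a2 * c2 = 0" using A1 A2 ee unfolding d_def by algebra
qed

lemma smooth_on_differentiable: "smooth_on S f \<Longrightarrow> p \<in> S \<Longrightarrow> f differentiable (at p)"
  unfolding smooth_on_def by (metis diff_order_on.simps(2))

lemma adapted_frameD:
  assumes "adapted_frame r U X E" and "p \<in> U" and "i \<in> {1..4}"
  shows "smooth_on U (E i)" and "ip (E i p) (E i p) \<in> {1, -1}"
    and "\<And>j. j \<in> {1..4} \<Longrightarrow> i \<noteq> j \<Longrightarrow> ip (E i p) (E j p) = 0"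
  using assms unfolding adapted_frame_def by blast+

lemma adapted_frame_tangent:
  assumes "adapted_frame r U X E" and "p \<in> U" and "i \<in> {1,2}"
  shows "smooth_on U (X i)" and "E i p = deriv_along (X i) r p"
  using assms unfolding adapted_frame_def by blast+

lemma sum_12: "sum f {1, 2 :: nat} = f 1 + f 2"
  by simp

text \<open>The terms with derivatives of the frame cancel, because \<open>\<nabla>\<close> of a parameter field differs
  from its ordinary derivative by a tensor; only traces with respect to the frame remain.\<close>

lemma laplacian_orthogonal_coordinates:
  assumes U: "open U" and fr: "adapted_frame r U X E" and p: "p \<in> U"
    and rj: "second_order_jet U r rs rt rss rst rtt"
    and Fj: "second_order_jet U F Fs Ft Fss Fst Ftt"
    and orth: "ip (rs p) (rt p) = 0" "ip (rs p) (rs p) \<noteq> 0" "ip (rt p) (rt p) \<noteq> 0"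
    and T: "T = (1 / ip (rs p) (rs p)) *\<^sub>R rss p + (1 / ip (rt p) (rt p)) *\<^sub>R rtt p"
  shows "laplacian r X E F p =
      (ip T (rs p) / ip (rs p) (rs p)) *\<^sub>R Fs p + (ip T (rt p) / ip (rt p) (rt p)) *\<^sub>R Ft p
      - (1 / ip (rs p) (rs p)) *\<^sub>R Fss p - (1 / ip (rt p) (rt p)) *\<^sub>R Ftt p"
proof -
  define A where "A = ip (rs p) (rs p)"
  define B where "B = ip (rt p) (rt p)"
  define e1 where "e1 = eps E 1 p"
  define e2 where "e2 = eps E 2 p"
  obtain a1 c1 where X1: "X 1 p = (a1, c1)" by fastforce
  obtain a2 c2 where X2: "X 2 p = (a2, c2)" by fastforce
  obtain y1 w1 where Y1: "deriv_along (X 1) (X 1) p = (y1, w1)" by fastforce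
  obtain y2 w2 where Y2: "deriv_along (X 2) (X 2) p = (y2, w2)" by fastforce
  have dX: "X 1 differentiable (at p)" "X 2 differentiable (at p)"
    using adapted_frame_tangent(1)[OF fr p] smooth_on_differentiable p by blast+
  have E1: "E 1 p = a1 *\<^sub>R rs p + c1 *\<^sub>R rt p" and E2: "E 2 p = a2 *\<^sub>R rs p + c2 *\<^sub>R rt p"
    using adapted_frame_tangent(2)[OF fr p, of 1] adapted_frame_tangent(2)[OF fr p, of 2]
    by (simp_all add: deriv_along_jet[OF rj p] X1[unfolded One_nat_def] X2)
  have e: "e1 \<in> {1, -1}" "e2 \<in> {1, -1}" and o: "ip (E 1 p) (E 2 p) = 0"
    unfolding e1_def e2_def eps_def
    by (intro adapted_frameD[OF fr p]; simp)+
  have o': "ip (rt p) (rs p) = 0" using orth by (simp add: ip_commute)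
  have k1: "a1\<^sup>2 * A + c1\<^sup>2 * B = e1" and k2: "a2\<^sup>2 * A + c2\<^sup>2 * B = e2"
    unfolding e1_def e2_def eps_def E1 E2 A_def B_def
    by (simp_all add: orth(1) o' ip_linear power2_eq_square)
  have k3: "a1 * a2 * A + c1 * c2 * B = 0"
    using o unfolding E1 E2 A_def B_def by (simp add: orth(1) o' ip_linear ac_simps)
  have AB: "A \<noteq> 0" "B \<noteq> 0" using orth A_def B_def by auto
  note tr = frame_trace[OF k1 k2 k3 e]
  have t1: "e1 * a1\<^sup>2 + e2 * a2\<^sup>2 = 1 / A" and t2: "e1 * c1\<^sup>2 + e2 * c2\<^sup>2 = 1 / B"
    and t3: "e1 * a1 * c1 + e2 * a2 * c2 = 0"
    using tr AB by (simp_all add: field_simps)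
  \<comment> \<open>\<open>h\<close> and \<open>H\<close> are the second derivatives of
    \<open>r\<close> and \<open>F\<close> in direction (a, c), with the derivative of the frame
    field left out.\<close>
  define h where "h = (\<lambda>a c. a\<^sup>2 *\<^sub>R rss p + (2 * a * c) *\<^sub>R rst p + c\<^sup>2 *\<^sub>R rtt p)"
  define H where "H = (\<lambda>a c. a\<^sup>2 *\<^sub>R Fss p + (2 * a * c) *\<^sub>R Fst p + c\<^sup>2 *\<^sub>R Ftt p)"
  have tracer: "e1 *\<^sub>R h a1 c1 + e2 *\<^sub>R h a2 c2 = T"
  proof -
    have "e1 *\<^sub>R h a1 c1 + e2 *\<^sub>R h a2 c2 = (e1 * a1\<^sup>2 + e2 * a2\<^sup>2) *\<^sub>R rss p
       + (2 * (e1 * a1 * c1 + e2 * a2 * c2)) *\<^sub>R rst p + (e1 * c1\<^sup>2 + e2 * c2\<^sup>2) *\<^sub>R rtt p"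
      unfolding h_def by (simp add: algebra_simps)
    then show ?thesis unfolding t1 t2 t3 by (simp add: T A_def B_def)
  qed
  have traceF: "e1 *\<^sub>R H a1 c1 + e2 *\<^sub>R H a2 c2 = (1 / A) *\<^sub>R Fss p + (1 / B) *\<^sub>R Ftt p"
  proof -
    have "e1 *\<^sub>R H a1 c1 + e2 *\<^sub>R H a2 c2 = (e1 * a1\<^sup>2 + e2 * a2\<^sup>2) *\<^sub>R Fss p
       + (2 * (e1 * a1 * c1 + e2 * a2 * c2)) *\<^sub>R Fst p + (e1 * c1\<^sup>2 + e2 * c2\<^sup>2) *\<^sub>R Ftt p"
      unfolding H_def by (simp add: algebra_simps)
    then show ?thesis unfolding t1 t2 t3 by simp
  qed
  \<comment> \<open>The parameter representative of the tangential part of \<open>V\<close>,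
    expanded in the frame; the next identity removes the frame from it.\<close>
  define N where "N = (\<lambda>V. (e1 * ip V (E 1 p)) *\<^sub>R (a1, c1) + (e2 * ip V (E 2 p)) *\<^sub>R (a2, c2))"
  have N: "N V = (ip V (rs p) / A, ip V (rt p) / B)" for V
  proof -
    have "N V = ((e1 * a1\<^sup>2 + e2 * a2\<^sup>2) * ip V (rs p) + (e1 * a1 * c1 + e2 * a2 * c2) * ip V (rt p),
          (e1 * a1 * c1 + e2 * a2 * c2) * ip V (rs p) + (e1 * c1\<^sup>2 + e2 * c2\<^sup>2) * ip V (rt p))"
      unfolding N_def E1 E2 by (simp add: ip_linear algebra_simps power2_eq_square)
    then show ?thesis unfolding t1 t2 t3 by simp
  qed
  have nab: "nabla r X E (X 1) (X 1) p = N (h a1 c1) + (y1, w1)"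
     "nabla r X E (X 2) (X 2) p = N (h a2 c2) + (y2, w2)"
  proof -
    have "nabla r X E (X 1) (X 1) p = N (h a1 c1 + (y1 *\<^sub>R rs p + w1 *\<^sub>R rt p))"
      "nabla r X E (X 2) (X 2) p = N (h a2 c2 + (y2 *\<^sub>R rs p + w2 *\<^sub>R rt p))"
      unfolding nabla_def sum_12 deriv_along_twice_jet[OF rj p U dX(1)] deriv_along_twice_jet[OF rj p U dX(2)]
      unfolding X1 X2 Y1 Y2 N_def h_def e1_def e2_def fst_conv snd_conv by (rule refl)+
    \<comment> \<open>\<open>N\<close> inverts the differential of \<open>r\<close> on tangent
      vectors, so the derivative of the frame field passes through it unchanged.\<close>
    moreover have "N (V + (y *\<^sub>R rs p + w *\<^sub>R rt p)) = N V + (y, w)" for V y w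
      using AB unfolding N by (simp add: ip_linear orth(1) o' add_divide_distrib A_def B_def)
    ultimately show "nabla r X E (X 1) (X 1) p = N (h a1 c1) + (y1, w1)"
     "nabla r X E (X 2) (X 2) p = N (h a2 c2) + (y2, w2)"
      by metis+
  qed
  have D: "deriv_along (X 1) (deriv_along (X 1) F) p = H a1 c1 + (y1 *\<^sub>R Fs p + w1 *\<^sub>R Ft p)"
     "deriv_along (X 2) (deriv_along (X 2) F) p = H a2 c2 + (y2 *\<^sub>R Fs p + w2 *\<^sub>R Ft p)"
    unfolding deriv_along_twice_jet[OF Fj p U dX(1)] deriv_along_twice_jet[OF Fj p U dX(2)] X1 X2 Y1 Y2 H_def
    by simp_all
  have "laplacian r X E F p =
     (fst (e1 *\<^sub>R N (h a1 c1) + e2 *\<^sub>R N (h a2 c2)) *\<^sub>R Fs p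
       + snd (e1 *\<^sub>R N (h a1 c1) + e2 *\<^sub>R N (h a2 c2)) *\<^sub>R Ft p)
       - (e1 *\<^sub>R H a1 c1 + e2 *\<^sub>R H a2 c2)"
    unfolding laplacian_def sum_12 D deriv_along_jet[OF Fj p] nab e1_def[symmetric] e2_def[symmetric]
    by (simp add: algebra_simps)
  also have "e1 *\<^sub>R N (h a1 c1) + e2 *\<^sub>R N (h a2 c2) = N (e1 *\<^sub>R h a1 c1 + e2 *\<^sub>R h a2 c2)"
    unfolding N by (simp add: ip_linear add_divide_distrib)
  finally show ?thesis
    unfolding tracer traceF N by (simp add: A_def B_def)
qed

text \<open>Beltrami's formula. Both sides trace the same expression, because the second fundamental
  form is the ambient second derivative minus its tangential part. Zero mean curvature can thus be
  read off from the coordinate formula for the Laplacian of \<open>r\<close>.\<close>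

lemma mean_curvature_vector_eq_laplacian:
  "mean_curvature_vector r X E p = - (1 / 2) *\<^sub>R laplacian r X E r p"
proof -
  have "(1 / 2) *\<^sub>R (e *\<^sub>R (A - B) + e' *\<^sub>R (A' - B')) = - (1 / 2) *\<^sub>R (e *\<^sub>R (B - A) + e' *\<^sub>R (B' - A'))"
    for e e' and A B A' B' :: "real ^ 4"
    by (simp add: scaleR_diff_right scaleR_add_right)
  then show ?thesis
    unfolding mean_curvature_vector_def laplacian_def second_fundamental_form_def sum_12 .
qed

section \<open>Calculus of smooth maps\<close>

lemma frechet_derivative_cong_open:
  assumes "open S" and "p \<in> S" and "\<And>q. q \<in> S \<Longrightarrow> f q = g q" and "f differentiable (at p)"
  shows "g differentiable (at p)" and "frechet_derivative g (at p) = frechet_derivative f (at p)"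
proof -
  have "(f has_derivative frechet_derivative f (at p)) (at p)"
    using assms(4) frechet_derivative_works by blast
  then have *: "(g has_derivative frechet_derivative f (at p)) (at p)"
    by (rule has_derivative_transform_within_open[OF _ assms(1,2,3)])
  then show "g differentiable (at p)" by (rule differentiableI)
  show "frechet_derivative g (at p) = frechet_derivative f (at p)"
    using frechet_derivative_at[OF *] by simp
qed

lemma diff_order_on_cong:
  assumes "open S" and "\<And>p. p \<in> S \<Longrightarrow> f p = g p" and "diff_order_on S f n"
  shows "diff_order_on S g n"
  using assms(2,3)
proof (induction n arbitrary: f g)
  case 0
  then show ?case by (simp cong: continuous_on_cong)
next
  case (Suc n)
  have d: "f differentiable (at p)" if "p \<in> S" for p using Suc.prems that by simp
  note c = frechet_derivative_cong_open[OF \<open>open S\<close> _ Suc.prems(1) d]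
  have "diff_order_on S (\<lambda>p. frechet_derivative g (at p) v) n" for v
    by (rule Suc.IH[of "\<lambda>p. frechet_derivative f (at p) v"]) (use Suc.prems c in auto)
  then show ?case using c by simp
qed

text \<open>An explicit derivative may replace \<open>frechet_derivative\<close>, since the two
  agree on the open set \<open>S\<close>. This is the induction step of the closure rules for sums,
  products and inverses.\<close>

lemma diff_order_on_SucI:
  assumes "open S" and "\<And>p. p \<in> S \<Longrightarrow> (f has_derivative f' p) (at p)"
    and "\<And>v. diff_order_on S (\<lambda>p. f' p v) n"
  shows "diff_order_on S f (Suc n)"
proof -
  have "diff_order_on S (\<lambda>p. frechet_derivative f (at p) v) n" for v
    by (rule diff_order_on_cong[OF assms(1) _ assms(3)[of v]])
       (use frechet_derivative_at[OF assms(2)] in metis)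
  then show ?thesis using differentiableI[OF assms(2)] by simp
qed

lemma diff_order_on_SucD:
  assumes "diff_order_on S f (Suc n)"
  shows "p \<in> S \<Longrightarrow> (f has_derivative frechet_derivative f (at p)) (at p)"
    and "diff_order_on S (\<lambda>p. frechet_derivative f (at p) v) n"
  using assms frechet_derivative_works by auto

lemma diff_order_on_less: "diff_order_on S f (Suc n) \<Longrightarrow> diff_order_on S f n"
proof (induction n arbitrary: f)
  case 0
  then show ?case
    by (auto intro!: continuous_at_imp_continuous_on differentiable_imp_continuous_within)
next
  case (Suc n)
  then show ?case by simp
qed

lemma diff_order_on_const: "open S \<Longrightarrow> diff_order_on S (\<lambda>p. c) n"
  by (induction n arbitrary: c) simp_all

lemma diff_order_on_add:
  assumes "open S" and "diff_order_on S f n" and "diff_order_on S g n"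
  shows "diff_order_on S (\<lambda>p. f p + g p) n"
  using assms(2,3)
proof (induction n arbitrary: f g)
  case 0
  then show ?case by (auto intro: continuous_intros)
next
  case (Suc n)
  show ?case
    by (rule diff_order_on_SucI[OF \<open>open S\<close>
          has_derivative_add[OF diff_order_on_SucD(1)[OF Suc.prems(1)] diff_order_on_SucD(1)[OF Suc.prems(2)]]])
       (use Suc.IH diff_order_on_SucD(2)[OF Suc.prems(1)] diff_order_on_SucD(2)[OF Suc.prems(2)] in auto)
qed

lemma diff_order_on_mult:
  fixes f g :: "'a::real_normed_vector \<Rightarrow> real"
  assumes "open S" and "diff_order_on S f n" and "diff_order_on S g n"
  shows "diff_order_on S (\<lambda>p. f p * g p) n"
  using assms(2,3)
proof (induction n arbitrary: f g)
  case 0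
  then show ?case by (auto intro: continuous_intros)
next
  case (Suc n)
  show ?case
    by (rule diff_order_on_SucI[OF \<open>open S\<close>
          has_derivative_mult[OF diff_order_on_SucD(1)[OF Suc.prems(1)] diff_order_on_SucD(1)[OF Suc.prems(2)]]])
       (assumption | intro diff_order_on_add[OF \<open>open S\<close>] Suc.IH diff_order_on_SucD(2)[OF Suc.prems(1)]
         diff_order_on_SucD(2)[OF Suc.prems(2)] diff_order_on_less[OF Suc.prems(1)]
         diff_order_on_less[OF Suc.prems(2)])+
qed

text \<open>The derivative of 1/f is a product of 1/f and the derivative of f, so the induction
  hypothesis for 1/f at the lower order suffices.\<close>

lemma diff_order_on_inverse:
  fixes f :: "'a::real_normed_vector \<Rightarrow> real"
  assumes "open S" and "diff_order_on S f n" and "\<And>p. p \<in> S \<Longrightarrow> f p \<noteq> 0"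
  shows "diff_order_on S (\<lambda>p. inverse (f p)) n"
  using assms(2)
proof (induction n)
  case 0
  then show ?case using assms(3) by (auto intro: continuous_intros)
next
  case (Suc n)
  have "((\<lambda>q. inverse (f q)) has_derivative
      (\<lambda>v. (- 1) * (inverse (f p) * (frechet_derivative f (at p) v * inverse (f p))))) (at p)" if "p \<in> S" for p
    by (rule has_derivative_eq_rhs[OF Deriv.has_derivative_inverse[OF assms(3)[OF that] diff_order_on_SucD(1)[OF Suc.prems that]]])
       (auto simp: mult_ac)
  moreover have "diff_order_on S
      (\<lambda>p. (- 1) * (inverse (f p) * (frechet_derivative f (at p) v * inverse (f p)))) n" for v
    by (intro diff_order_on_mult[OF \<open>open S\<close>] diff_order_on_const[OF \<open>open S\<close>]
        Suc.IH diff_order_on_less[OF Suc.prems] diff_order_on_SucD(2)[OF Suc.prems])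
  ultimately show ?case
    by (rule diff_order_on_SucI[OF \<open>open S\<close>])
qed

lemma diff_order_on_fst:
  fixes f :: "'a::real_normed_vector \<Rightarrow> 'c::real_normed_vector" and T :: "'b::real_normed_vector set"
  assumes "open S" and "open T" and "diff_order_on S f n"
  shows "diff_order_on (S \<times> T) (\<lambda>p. f (fst p)) n"
  using assms(3)
proof (induction n arbitrary: f)
  case 0
  then show ?case by (auto intro!: continuous_on_compose2[of S f] continuous_intros)
next
  case (Suc n)
  have "((\<lambda>q. f (fst q)) has_derivative (\<lambda>v. frechet_derivative f (at (fst p)) (fst v))) (at p)"
    if "p \<in> S \<times> T" for p :: "'a \<times> 'b"
    using diff_order_on_SucD(1)[OF Suc.prems, of "fst p"] that
    by (auto intro: has_derivative_compose[OF has_derivative_fst[OF has_derivative_ident]])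
  moreover have "diff_order_on (S \<times> T) (\<lambda>p. frechet_derivative f (at (fst p)) (fst v)) n" for v :: "'a \<times> 'b"
    using Suc.IH[OF diff_order_on_SucD(2)[OF Suc.prems]] .
  ultimately show ?case
    by (rule diff_order_on_SucI[OF open_Times[OF assms(1,2)]])
qed

lemma smooth_on_const: "open S \<Longrightarrow> smooth_on S (\<lambda>p. c)"
  by (simp add: smooth_on_def diff_order_on_const)

lemma smooth_on_add: "open S \<Longrightarrow> smooth_on S f \<Longrightarrow> smooth_on S g \<Longrightarrow> smooth_on S (\<lambda>p. f p + g p)"
  by (simp add: smooth_on_def diff_order_on_add)

lemma smooth_on_mult:
  fixes f g :: "'a::real_normed_vector \<Rightarrow> real"
  shows "open S \<Longrightarrow> smooth_on S f \<Longrightarrow> smooth_on S g \<Longrightarrow> smooth_on S (\<lambda>p. f p * g p)"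
  by (simp add: smooth_on_def diff_order_on_mult)

lemma smooth_on_diff:
  fixes f g :: "'a::real_normed_vector \<Rightarrow> real"
  assumes "open S" and "smooth_on S f" and "smooth_on S g"
  shows "smooth_on S (\<lambda>p. f p - g p)"
  using smooth_on_add[OF assms(1,2) smooth_on_mult[OF assms(1) smooth_on_const[OF assms(1), of "-1"] assms(3)]]
  by simp

lemma smooth_on_power:
  fixes f :: "'a::real_normed_vector \<Rightarrow> real"
  assumes "open S" and "smooth_on S f"
  shows "smooth_on S (\<lambda>p. f p ^ n)"
  by (induction n) (simp_all add: assms smooth_on_const smooth_on_mult)

lemma smooth_on_divide:
  fixes f g :: "'a::real_normed_vector \<Rightarrow> real"
  assumes "open S" and "smooth_on S f" and "smooth_on S g" and "\<And>p. p \<in> S \<Longrightarrow> g p \<noteq> 0"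
  shows "smooth_on S (\<lambda>p. f p / g p)"
  using smooth_on_mult[OF assms(1,2), of "\<lambda>p. inverse (g p)"] assms
  by (simp add: smooth_on_def diff_order_on_inverse divide_inverse)

lemma smooth_on_fst:
  "open S \<Longrightarrow> open T \<Longrightarrow> smooth_on S f \<Longrightarrow> smooth_on (S \<times> T) (\<lambda>p. f (fst p))"
  by (simp add: smooth_on_def diff_order_on_fst)

lemma smooth_on_has_real_derivative:
  fixes f :: "real \<Rightarrow> real"
  assumes "smooth_on S f" and "s \<in> S"
  shows "(f has_real_derivative deriv f s) (at s)"
  using smooth_on_differentiable[OF assms] DERIV_deriv_iff_real_differentiable by blast

lemma smooth_on_deriv:
  fixes f :: "real \<Rightarrow> real"
  assumes "open S" and "smooth_on S f"
  shows "smooth_on S (deriv f)"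
  unfolding smooth_on_def
proof
  fix n
  have a: "diff_order_on S (\<lambda>p. frechet_derivative f (at p) 1) n"
    using assms(2) unfolding smooth_on_def by (metis diff_order_on.simps(2))
  have "frechet_derivative f (at p) 1 = deriv f p" if "p \<in> S" for p
    using fun_cong[OF frechet_derivative_at[OF smooth_on_has_real_derivative[OF assms(2) that, unfolded has_field_derivative_def]], of 1]
    by simp
  then show "diff_order_on S (deriv f) n"
    by (rule diff_order_on_cong[OF assms(1) _ a])
qed

section \<open>Vectors rotating with constant frequency\<close>

definition rotating :: "real \<Rightarrow> 'a::real_normed_vector \<Rightarrow> 'a \<Rightarrow> real \<Rightarrow> 'a" where
  "rotating k A B t = cos (k * t) *\<^sub>R A + sin (k * t) *\<^sub>R B"

text \<open>Differentiation stays in the family: the pair (A, B) becomes (B, -A) with factor k, so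
  two derivatives give the factor -k^2. Constant vectors are the case k = 0.\<close>

lemma rotating_has_vector_derivative:
  "(rotating k A B has_vector_derivative k *\<^sub>R rotating k B (- A) t) (at t)"
proof -
  have "((\<lambda>t. cos (k * t) *\<^sub>R A + sin (k * t) *\<^sub>R B) has_vector_derivative
      (- sin (k * t) * k) *\<^sub>R A + (cos (k * t) * k) *\<^sub>R B) (at t)"
    by (auto intro!: derivative_eq_intros simp: algebra_simps)
  then show ?thesis
    unfolding rotating_def[abs_def] by (simp add: algebra_simps)
qed

lemma second_order_jet_rotating:
  assumes "\<And>s. s \<in> S \<Longrightarrow> (f has_real_derivative f1 s) (at s)"
    and "\<And>s. s \<in> S \<Longrightarrow> (f1 has_real_derivative f2 s) (at s)"
  shows "second_order_jet (S \<times> T) (\<lambda>p. f (fst p) *\<^sub>R rotating k A B (snd p))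
     (\<lambda>p. f1 (fst p) *\<^sub>R rotating k A B (snd p)) (\<lambda>p. f (fst p) *\<^sub>R (k *\<^sub>R rotating k B (- A) (snd p)))
     (\<lambda>p. f2 (fst p) *\<^sub>R rotating k A B (snd p)) (\<lambda>p. f1 (fst p) *\<^sub>R (k *\<^sub>R rotating k B (- A) (snd p)))
     (\<lambda>p. f (fst p) *\<^sub>R (- (k\<^sup>2) *\<^sub>R rotating k A B (snd p)))"
proof -
  have sep: "((\<lambda>p. g (fst p) *\<^sub>R W (snd p)) has_derivative
      (\<lambda>v. fst v *\<^sub>R (g' *\<^sub>R W (snd p)) + snd v *\<^sub>R (g (fst p) *\<^sub>R W'))) (at p)"
    if "(g has_real_derivative g') (at (fst p))" and "(W has_vector_derivative W') (at (snd p))"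
    for g g' and W :: "real \<Rightarrow> 'a" and W' and p :: "real \<times> real"
  proof -
    have "((\<lambda>p. g (fst p)) has_derivative (\<lambda>v. fst v * g')) (at p)"
      using that(1) unfolding has_field_derivative_def mult.commute[of g']
      by (rule has_derivative_compose[OF has_derivative_fst[OF has_derivative_ident]])
    moreover have "((\<lambda>p. W (snd p)) has_derivative (\<lambda>v. snd v *\<^sub>R W')) (at p)"
      using that(2) unfolding has_vector_derivative_def
      by (rule has_derivative_compose[OF has_derivative_snd[OF has_derivative_ident]])
    ultimately show ?thesis
      by (rule has_derivative_eq_rhs[OF has_derivative_scaleR]) (simp add: algebra_simps fun_eq_iff)
  qed
  have r2: "((\<lambda>t. k *\<^sub>R rotating k B (- A) t) has_vector_derivative - (k\<^sup>2) *\<^sub>R rotating k A B t) (at t)" for t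
  proof -
    have "((\<lambda>t. k *\<^sub>R rotating k B (- A) t) has_vector_derivative k *\<^sub>R (k *\<^sub>R rotating k (- A) (- B) t)) (at t)"
      by (intro bounded_linear.has_vector_derivative[OF bounded_linear_scaleR_right]
          rotating_has_vector_derivative)
    moreover have "k *\<^sub>R (k *\<^sub>R rotating k (- A) (- B) t) = - (k\<^sup>2) *\<^sub>R rotating k A B t"
      by (simp add: rotating_def algebra_simps power2_eq_square)
    ultimately show ?thesis by simp
  qed
  show ?thesis
    unfolding second_order_jet_def
    by (intro ballI conjI sep) (use assms rotating_has_vector_derivative r2 in auto)
qed

section \<open>Rotational surfaces\<close>

text \<open>A moving pseudo-orthonormal basis: in each of the two rotation planes a unit radial
  vector and its quarter turn. With respect to it the surface and its partial derivatives have
  coefficients depending on s only.\<close>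

definition frame1 :: "real \<Rightarrow> real ^ 4" where "frame1 = rotating 1 (axis 1 1) (axis 2 1)"
definition frame2 :: "real \<Rightarrow> real ^ 4" where "frame2 = rotating 1 (axis 2 1) (- axis 1 1)"
definition frame3 :: "real \<Rightarrow> real \<Rightarrow> real ^ 4" where "frame3 b = rotating b (axis 3 1) (axis 4 1)"
definition frame4 :: "real \<Rightarrow> real \<Rightarrow> real ^ 4" where "frame4 b = rotating b (axis 4 1) (- axis 3 1)"

lemma frame_nth:
  "frame1 t $ 1 = cos t" "frame1 t $ 2 = sin t" "frame1 t $ 3 = 0" "frame1 t $ 4 = 0"
  "frame2 t $ 1 = - sin t" "frame2 t $ 2 = cos t" "frame2 t $ 3 = 0" "frame2 t $ 4 = 0"
  "frame3 b t $ 1 = 0" "frame3 b t $ 2 = 0" "frame3 b t $ 3 = cos (b * t)" "frame3 b t $ 4 = sin (b * t)"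
  "frame4 b t $ 1 = 0" "frame4 b t $ 2 = 0" "frame4 b t $ 3 = - sin (b * t)" "frame4 b t $ 4 = cos (b * t)"
  by (simp_all add: frame1_def frame2_def frame3_def frame4_def rotating_def axis_def)

lemma ip_frame:
  "ip (frame1 t) (frame1 t) = 1" "ip (frame2 t) (frame2 t) = 1"
  "ip (frame3 b t) (frame3 b t) = - 1" "ip (frame4 b t) (frame4 b t) = - 1"
  "ip (frame1 t) (frame2 t) = 0" "ip (frame1 t) (frame3 b t) = 0" "ip (frame1 t) (frame4 b t) = 0"
  "ip (frame2 t) (frame1 t) = 0" "ip (frame2 t) (frame3 b t) = 0" "ip (frame2 t) (frame4 b t) = 0"
  "ip (frame3 b t) (frame1 t) = 0" "ip (frame3 b t) (frame2 t) = 0" "ip (frame3 b t) (frame4 b t) = 0"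
  "ip (frame4 b t) (frame1 t) = 0" "ip (frame4 b t) (frame2 t) = 0" "ip (frame4 b t) (frame3 b t) = 0"
  using sin_cos_squared_add[of t] sin_cos_squared_add[of "b * t"]
  by (simp_all add: ip_def frame_nth power2_eq_square algebra_simps)

lemma frame_expansion:
  "y = ip y (frame1 t) *\<^sub>R frame1 t + ip y (frame2 t) *\<^sub>R frame2 t - ip y (frame3 b t) *\<^sub>R frame3 b t - ip y (frame4 b t) *\<^sub>R frame4 b t"
proof -
  have t: "sin t * sin t = 1 - cos t * cos t" "sin (b * t) * sin (b * t) = 1 - cos (b * t) * cos (b * t)"
    using sin_cos_squared_add[of t] sin_cos_squared_add[of "b * t"] by (simp_all add: power2_eq_square)
  show ?thesis
    by (simp add: vec_eq_iff forall_4 frame_nth ip_def) (intro conjI; use t in algebra)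
qed

lemma frame_independent:
  assumes "a1 *\<^sub>R frame1 t + a2 *\<^sub>R frame2 t + a3 *\<^sub>R frame3 b t + a4 *\<^sub>R frame4 b t = 0"
  shows "a1 = 0" "a2 = 0" "a3 = 0" "a4 = 0"
proof -
  define v where "v = a1 *\<^sub>R frame1 t + a2 *\<^sub>R frame2 t + a3 *\<^sub>R frame3 b t + a4 *\<^sub>R frame4 b t"
  have "ip v (frame1 t) = a1" "ip v (frame2 t) = a2" "ip v (frame3 b t) = - a3" "ip v (frame4 b t) = - a4"
    by (simp_all add: v_def ip_linear ip_frame)
  moreover have "ip v w = 0" for w
    using assms by (simp add: v_def ip_def)
  ultimately show "a1 = 0" "a2 = 0" "a3 = 0" "a4 = 0" by auto
qed

lemma vector_4:
  "(vector [x, y, z, w] :: ('a::zero) ^ 4) $ 1 = x" "(vector [x, y, z, w] :: ('a::zero) ^ 4) $ 2 = y"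
  "(vector [x, y, z, w] :: ('a::zero) ^ 4) $ 3 = z" "(vector [x, y, z, w] :: ('a::zero) ^ 4) $ 4 = w"
  unfolding vector_def by simp_all

lemma rot_surface_eq: "rot_surface b x z = (\<lambda>p. x (fst p) *\<^sub>R frame1 (snd p) + z (fst p) *\<^sub>R frame3 b (snd p))"
  by (simp add: rot_surface_def fun_eq_iff vec_eq_iff forall_4 frame_nth vector_4)

section \<open>Induced metric and Laplacian of a rotational surface\<close>

locale rotational_profile =
  fixes b :: real and I :: "real set" and x z :: "real \<Rightarrow> real"
  assumes open_I: "open I" and interval_I: "is_interval I" and nonempty_I: "I \<noteq> {}"
    and smooth_x: "smooth_on I x" and smooth_z: "smooth_on I z"
    and regular: "regular_profile b I x z"
begin

abbreviation "U \<equiv> rot_domain I"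
abbreviation "r \<equiv> rot_surface b x z"
abbreviation "x1 \<equiv> deriv x"
abbreviation "z1 \<equiv> deriv z"
abbreviation "x2 \<equiv> deriv x1"
abbreviation "z2 \<equiv> deriv z1"

definition metric_E :: "real \<Rightarrow> real" where "metric_E s = (x1 s)\<^sup>2 - (z1 s)\<^sup>2"
definition metric_G :: "real \<Rightarrow> real" where "metric_G s = (x s)\<^sup>2 - b\<^sup>2 * (z s)\<^sup>2"
text \<open>The trace g^(ij) Gamma^s_(ij) of the Christoffel symbols of E ds^2 + G dt^2, that is
  (E'/(2E) - G'/(2G)) / E.\<close>

definition christoffel :: "real \<Rightarrow> real" where
  "christoffel s = ((x1 s * x2 s - z1 s * z2 s) / metric_E s - (x s * x1 s - b\<^sup>2 * z s * z1 s) / metric_G s) / metric_E s"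

lemma open_U: "open U"
  unfolding rot_domain_def using open_I by (intro open_Times) auto

lemma metric_E_nz: "s \<in> I \<Longrightarrow> metric_E s \<noteq> 0" and metric_G_nz: "s \<in> I \<Longrightarrow> metric_G s \<noteq> 0"
  using regular unfolding regular_profile_def metric_E_def metric_G_def by auto

lemma profile_derivs:
  assumes "s \<in> I"
  shows "(x has_real_derivative x1 s) (at s)" "(z has_real_derivative z1 s) (at s)"
    "(x1 has_real_derivative x2 s) (at s)" "(z1 has_real_derivative z2 s) (at s)"
  using smooth_on_has_real_derivative[OF _ assms] smooth_x smooth_z smooth_on_deriv[OF open_I] by auto

definition rs where "rs p = x1 (fst p) *\<^sub>R frame1 (snd p) + z1 (fst p) *\<^sub>R frame3 b (snd p)"
definition rt where "rt p = x (fst p) *\<^sub>R frame2 (snd p) + (b * z (fst p)) *\<^sub>R frame4 b (snd p)"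
definition rss where "rss p = x2 (fst p) *\<^sub>R frame1 (snd p) + z2 (fst p) *\<^sub>R frame3 b (snd p)"
definition rtt where "rtt p = (- x (fst p)) *\<^sub>R frame1 (snd p) + (- (b\<^sup>2) * z (fst p)) *\<^sub>R frame3 b (snd p)"

text \<open>The mixed derivative stays existential because the formula for the Laplacian in
  orthogonal coordinates does not contain it.\<close>

lemma surface_jet: "\<exists>rst. second_order_jet U r rs rt rss rst rtt"
proof -
  \<comment> \<open>The premises give \<open>rs\<close>, \<open>rt\<close>, \<open>rss\<close>,
    \<open>rtt\<close> the literal shape produced by the rules for sums and rotating vectors; their
    definitions match it up to rewriting.\<close>
  have "second_order_jet U (\<lambda>p. x (fst p) *\<^sub>R rotating 1 (axis 1 1) (axis 2 1) (snd p)
       + z (fst p) *\<^sub>R rotating b (axis 3 1) (axis 4 1) (snd p)) rs rt rss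
      (\<lambda>p. x1 (fst p) *\<^sub>R 1 *\<^sub>R rotating 1 (axis 2 1) (- axis 1 1) (snd p)
       + z1 (fst p) *\<^sub>R b *\<^sub>R rotating b (axis 4 1) (- axis 3 1) (snd p)) rtt"
    if "rs = (\<lambda>p. x1 (fst p) *\<^sub>R rotating 1 (axis 1 1) (axis 2 1) (snd p)
       + z1 (fst p) *\<^sub>R rotating b (axis 3 1) (axis 4 1) (snd p))"
     and "rt = (\<lambda>p. x (fst p) *\<^sub>R 1 *\<^sub>R rotating 1 (axis 2 1) (- axis 1 1) (snd p)
       + z (fst p) *\<^sub>R b *\<^sub>R rotating b (axis 4 1) (- axis 3 1) (snd p))"
     and "rss = (\<lambda>p. x2 (fst p) *\<^sub>R rotating 1 (axis 1 1) (axis 2 1) (snd p)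
       + z2 (fst p) *\<^sub>R rotating b (axis 3 1) (axis 4 1) (snd p))"
     and "rtt = (\<lambda>p. x (fst p) *\<^sub>R (- (1\<^sup>2) *\<^sub>R rotating 1 (axis 1 1) (axis 2 1) (snd p))
       + z (fst p) *\<^sub>R (- (b\<^sup>2) *\<^sub>R rotating b (axis 3 1) (axis 4 1) (snd p)))"
    unfolding that rot_domain_def
    by (intro second_order_jet_add second_order_jet_rotating profile_derivs)
  then show ?thesis
    unfolding rot_surface_eq fun_eq_iff rs_def rt_def rss_def rtt_def
    by (intro exI) (simp add: frame1_def frame2_def frame3_def frame4_def ac_simps)
qed

lemma ip_tangent:
  "ip (rs p) (rs p) = metric_E (fst p)" "ip (rt p) (rt p) = metric_G (fst p)" "ip (rs p) (rt p) = 0"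
  by (simp_all add: rs_def rt_def ip_linear ip_frame metric_E_def metric_G_def power2_eq_square)

text \<open>There is no \<open>Ft\<close> term: \<open>rss\<close> and \<open>rtt\<close> are
  combinations of \<open>frame1\<close> and \<open>frame3\<close>, whereas \<open>rt\<close> is one
  of \<open>frame2\<close> and \<open>frame4\<close>.\<close>

lemma laplacian_eq:
  assumes fr: "adapted_frame r U X E" and p: "p \<in> U"
    and F: "second_order_jet U F Fs Ft Fss Fst Ftt"
  shows "laplacian r X E F p =
    christoffel (fst p) *\<^sub>R Fs p - (1 / metric_E (fst p)) *\<^sub>R Fss p - (1 / metric_G (fst p)) *\<^sub>R Ftt p"
proof -
  have s: "fst p \<in> I" using p by (auto simp: rot_domain_def)
  obtain rst where rj: "second_order_jet U r rs rt rss rst rtt" using surface_jet by blast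
  have "ip (rss p) (rs p) = x1 (fst p) * x2 (fst p) - z1 (fst p) * z2 (fst p)"
    "ip (rtt p) (rs p) = - (x (fst p) * x1 (fst p) - b\<^sup>2 * z (fst p) * z1 (fst p))"
    "ip (rss p) (rt p) = 0" "ip (rtt p) (rt p) = 0"
    by (simp_all add: rs_def rt_def rss_def rtt_def ip_linear ip_frame)
  then have "ip ((1 / metric_E (fst p)) *\<^sub>R rss p + (1 / metric_G (fst p)) *\<^sub>R rtt p) (rs p) / metric_E (fst p) = christoffel (fst p)"
    and "ip ((1 / metric_E (fst p)) *\<^sub>R rss p + (1 / metric_G (fst p)) *\<^sub>R rtt p) (rt p) / metric_G (fst p) = 0"
    unfolding christoffel_def ip_linear by (simp_all add: diff_divide_distrib add_divide_distrib)
  then show ?thesis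
    using laplacian_orthogonal_coordinates[OF open_U fr p rj F _ _ _ refl] metric_E_nz[OF s] metric_G_nz[OF s]
    unfolding ip_tangent by simp
qed

end

section \<open>Zero mean curvature and the differential equations of the two halves\<close>

locale minimal_profile = rotational_profile +
  assumes zmc: "zero_mean_curvature (rot_surface b x z) (rot_domain I)"
begin

text \<open>The \<open>frame1\<close> and \<open>frame3\<close> components of the equation that the
  Laplacian of \<open>r\<close> vanishes; the other two are trivial. Since the coefficients do not
  involve t, the single value t = pi is enough.\<close>

lemma profile_equations:
  assumes s: "s \<in> I"
  shows "x2 s = metric_E s * (x s / metric_G s + christoffel s * x1 s)"
    and "z2 s = metric_E s * (b\<^sup>2 * z s / metric_G s + christoffel s * z1 s)"
proof -
  have p: "(s, pi) \<in> U" using s by (simp add: rot_domain_def)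
  obtain rst where rj: "second_order_jet U r rs rt rss rst rtt" using surface_jet by blast
  obtain X E where fr: "adapted_frame r U X E" and H: "mean_curvature_vector r X E (s, pi) = 0"
    using zmc p unfolding zero_mean_curvature_def by blast
  have "laplacian r X E r (s, pi) = 0"
    using H unfolding mean_curvature_vector_eq_laplacian by simp
  then have "(christoffel s * x1 s - x2 s / metric_E s + x s / metric_G s) *\<^sub>R frame1 pi + 0 *\<^sub>R frame2 pi +
     (christoffel s * z1 s - z2 s / metric_E s + b\<^sup>2 * z s / metric_G s) *\<^sub>R frame3 b pi + 0 *\<^sub>R frame4 b pi = 0"
    unfolding laplacian_eq[OF fr p rj] rs_def rss_def rtt_def by (simp add: algebra_simps)
  from frame_independent[OF this]
  show "x2 s = metric_E s * (x s / metric_G s + christoffel s * x1 s)"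
    "z2 s = metric_E s * (b\<^sup>2 * z s / metric_G s + christoffel s * z1 s)"
    using metric_E_nz[OF s] by (auto simp: field_simps)
qed

text \<open>\<open>nu_scale\<close> is \<open>|EG|\<close> to the power \<open>-1/2\<close>, written so that it is visibly differentiable
  without distinguishing the sign of \<open>EG\<close>. The constants below depend on a parameter \<open>c\<close> with values
  \<open>b\<close> and \<open>-b\<close>, corresponding to the two halves of the Gauss map.\<close>

definition nu_scale :: "real \<Rightarrow> real" where "nu_scale s = ((metric_E s * metric_G s)\<^sup>2) powr (- 1 / 4)"
text \<open>Up to sign the square root of |E/G|. If tau' = \<open>omega\<close>, then tau and t are
  isothermal: the metric is \<open>G\<close> times (\<open>metric_sign\<close> dtau^2 +
  dt^2).\<close>

definition omega :: "real \<Rightarrow> real" where "omega s = 1 / (nu_scale s * metric_G s)"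
text \<open>On \<open>I\<close> this is the sign of E G: 1 for a definite induced metric, -1 for an
  indefinite one.\<close>

definition metric_sign :: "real \<Rightarrow> real" where "metric_sign s = (nu_scale s)\<^sup>2 * (metric_E s * metric_G s)"
text \<open>Where x and z do not vanish, this is x z times the derivative of log |z| - c log |x|; it
  detects the profiles z = const |x|^c.\<close>

definition wronskian :: "real \<Rightarrow> real \<Rightarrow> real" where "wronskian c s = x s * z1 s - c * z s * x1 s"
text \<open>\<open>nu_rot\<close> and half of \<open>nu_const\<close> will be the coefficients of
  the rotating and of the fixed direction in one half of the unit normal bivector.\<close>

definition nu_rot :: "real \<Rightarrow> real \<Rightarrow> real" where "nu_rot c s = nu_scale s * wronskian c s / 2"
definition nu_const :: "real \<Rightarrow> real \<Rightarrow> real" where "nu_const c s = nu_scale s * (c * z s * z1 s - x s * x1 s)"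
definition half_eigenvalue :: "real \<Rightarrow> real \<Rightarrow> real" where
  "half_eigenvalue c s = - 2 * (1 + c)\<^sup>2 * (wronskian c s)\<^sup>2 / (metric_E s * (metric_G s)\<^sup>2)"

lemma nu_scale_pos: "s \<in> I \<Longrightarrow> nu_scale s > 0"
  using metric_E_nz metric_G_nz by (simp add: nu_scale_def)

lemma nu_scale_pow4: "s \<in> I \<Longrightarrow> (nu_scale s) ^ 4 * (metric_E s * metric_G s)\<^sup>2 = 1"
proof -
  assume s: "s \<in> I"
  have h: "(metric_E s * metric_G s)\<^sup>2 > 0" using metric_E_nz[OF s] metric_G_nz[OF s] by simp
  have "(nu_scale s) ^ 4 = nu_scale s powr 4" using nu_scale_pos[OF s] by (simp add: powr_numeral)
  also have "\<dots> = (metric_E s * metric_G s)\<^sup>2 powr (- 1)" unfolding nu_scale_def by (simp add: powr_powr)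
  also have "\<dots> = 1 / (metric_E s * metric_G s)\<^sup>2" using h by (simp add: powr_minus_divide)
  finally show ?thesis using h by simp
qed

lemma metric_sign_sq: "s \<in> I \<Longrightarrow> (metric_sign s)\<^sup>2 = 1"
  using nu_scale_pow4 by (simp add: metric_sign_def power_mult_distrib flip: power_mult)

lemma omega_sq: "s \<in> I \<Longrightarrow> (omega s)\<^sup>2 = metric_sign s * metric_E s / metric_G s"
proof -
  assume s: "s \<in> I"
  have "(nu_scale s)\<^sup>2 * (metric_G s)\<^sup>2 * (metric_sign s * metric_E s) = metric_G s"
    using metric_sign_sq[OF s] unfolding metric_sign_def by algebra
  then show ?thesis
    using nu_scale_pos[OF s] metric_G_nz[OF s] by (simp add: omega_def field_simps power2_eq_square)
qed

text \<open>Brahmagupta's identity (c z z' - x x')^2 - (x z' - c z x')^2 = (x^2 - c^2 z^2) (x'^2 -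
  z'^2), scaled by the square of \<open>nu_scale\<close>. Geometrically, each half of the Gauss map
  stays on a quadric.\<close>

lemma nu_coefficients_quadric: "c\<^sup>2 = b\<^sup>2 \<Longrightarrow> (nu_const c s)\<^sup>2 = metric_sign s + 4 * (nu_rot c s)\<^sup>2"
proof -
  assume c: "c\<^sup>2 = b\<^sup>2"
  have "4 * (nu_rot c s)\<^sup>2 = (nu_scale s * wronskian c s)\<^sup>2" unfolding nu_rot_def by (simp add: power_divide)
  then show ?thesis using c unfolding nu_const_def metric_sign_def wronskian_def metric_E_def metric_G_def by algebra
qed

lemma half_eigenvalue_eq: "s \<in> I \<Longrightarrow> half_eigenvalue c s = - 8 * (1 + c)\<^sup>2 * metric_sign s * (nu_rot c s)\<^sup>2 / metric_G s"
proof -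
  assume s: "s \<in> I"
  have "4 * (nu_rot c s)\<^sup>2 = (nu_scale s * wronskian c s)\<^sup>2" unfolding nu_rot_def by (simp add: power_divide)
  then have "4 * metric_sign s * (nu_rot c s)\<^sup>2 * (metric_E s * metric_G s) = (wronskian c s)\<^sup>2"
    using nu_scale_pow4[OF s] unfolding metric_sign_def by algebra
  then show ?thesis
    using metric_E_nz[OF s] metric_G_nz[OF s] unfolding half_eigenvalue_def
    by (simp add: field_simps power2_eq_square) algebra
qed

text \<open>The logarithmic derivative of |E G|^(-1/2) is -(E'/(2E) + G'/(2G)), whatever the signs
  of E and G.\<close>

lemma nu_scale_deriv:
  assumes s: "s \<in> I"
  shows "(nu_scale has_real_derivative - nu_scale s * ((x1 s * x2 s - z1 s * z2 s) / metric_E s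
      + (x s * x1 s - b\<^sup>2 * z s * z1 s) / metric_G s)) (at s)"
proof -
  note d = profile_derivs[OF s]
  define h where "h = metric_E s * metric_G s"
  define h' where "h' = 2 * (x1 s * x2 s - z1 s * z2 s) * metric_G s + metric_E s * (2 * (x s * x1 s - b\<^sup>2 * z s * z1 s))"
  have h: "h\<^sup>2 > 0" "h \<noteq> 0" using metric_E_nz[OF s] metric_G_nz[OF s] by (auto simp: h_def)
  have "((\<lambda>s. (metric_E s * metric_G s)\<^sup>2) has_real_derivative 2 * h * h') (at s)"
    unfolding metric_E_def metric_G_def
    by (rule derivative_eq_intros d refl)+ (simp add: h_def h'_def metric_E_def metric_G_def algebra_simps)
  from DERIV_chain2[OF has_real_derivative_powr this, of "- 1 / 4"] h
  have "(nu_scale has_real_derivative (- 1 / 4) * (h\<^sup>2) powr (- 1 / 4 - 1) * (2 * h * h')) (at s)"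
    unfolding nu_scale_def[abs_def] h_def by simp
  moreover have "(h\<^sup>2) powr (- 1 / 4 - 1) = nu_scale s / h\<^sup>2"
    unfolding nu_scale_def h_def[symmetric] powr_diff using h by simp
  moreover have "(- 1 / 4) * (nu_scale s / h\<^sup>2) * (2 * h * h') = - nu_scale s * (h' / (2 * h))"
    using h by (simp add: field_simps power2_eq_square)
  moreover have hh: "h' / (2 * h) = (x1 s * x2 s - z1 s * z2 s) / metric_E s + (x s * x1 s - b\<^sup>2 * z s * z1 s) / metric_G s"
    using metric_E_nz[OF s] metric_G_nz[OF s] unfolding h_def h'_def by (simp add: field_simps)
  ultimately show ?thesis unfolding hh by (metis DERIV_cong)
qed

text \<open>The logarithmic derivative of \<open>omega\<close> is E'/(2E) - G'/(2G). Equivalently, a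
  primitive tau of \<open>omega\<close> is a harmonic function of s.\<close>

lemma omega_deriv:
  assumes s: "s \<in> I"
  shows "(omega has_real_derivative omega s * (metric_E s * christoffel s)) (at s)"
proof -
  note d = profile_derivs[OF s] nu_scale_deriv[OF s]
  have nz: "nu_scale s \<noteq> 0" "metric_E s \<noteq> 0" "metric_G s \<noteq> 0" using nu_scale_pos[OF s] metric_E_nz[OF s] metric_G_nz[OF s] by auto
  define A where "A = (x1 s * x2 s - z1 s * z2 s) / metric_E s"
  define B where "B = (x s * x1 s - b\<^sup>2 * z s * z1 s) / metric_G s"
  have G: "(metric_G has_real_derivative 2 * B * metric_G s) (at s)"
    unfolding metric_G_def[abs_def] B_def
    by (rule derivative_eq_intros d refl)+ (use nz in \<open>simp add: metric_G_def\<close>)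
  have K: "(nu_scale has_real_derivative - nu_scale s * (A + B)) (at s)" using d(5) unfolding A_def B_def .
  have g: "metric_E s * christoffel s = A - B" using nz unfolding christoffel_def A_def B_def by simp
  have "((\<lambda>s. 1 / (nu_scale s * metric_G s)) has_real_derivative 1 / (nu_scale s * metric_G s) * (A - B)) (at s)"
    by (rule derivative_eq_intros G K refl)+ (use nz in \<open>simp_all add: field_simps\<close>)
  then show ?thesis unfolding omega_def[abs_def] g .
qed

text \<open>Substituting the profile equations for x'' and z'' closes the system. With P =
  \<open>nu_rot\<close>, D = \<open>nu_const\<close> and tau' = \<open>omega\<close> it reads
  dP/dtau = (1 + c) D P and dD/dtau = 4 (1 + c) P^2, and it preserves D^2 - 4 P^2.\<close>

lemma nu_coefficients_deriv:
  assumes s: "s \<in> I" and c: "c\<^sup>2 = b\<^sup>2"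
  shows "(nu_rot c has_real_derivative (1 + c) * omega s * nu_const c s * nu_rot c s) (at s)"
    and "(nu_const c has_real_derivative 4 * (1 + c) * omega s * (nu_rot c s)\<^sup>2) (at s)"
proof -
  note d = profile_derivs[OF s]
  have nz: "nu_scale s \<noteq> 0" "metric_E s \<noteq> 0" "metric_G s \<noteq> 0" using nu_scale_pos[OF s] metric_E_nz[OF s] metric_G_nz[OF s] by auto
  \<comment> \<open>\<open>A\<close> and \<open>B\<close> are E'/(2E) and G'/(2G). With
    \<open>v\<close> for 1/G the identities \<open>p\<close> and \<open>dd\<close> below become
    polynomial, subject to v G = 1, and \<open>A\<close> cancels in them.\<close>
  define A where "A = (x1 s * x2 s - z1 s * z2 s) / metric_E s"
  define B where "B = (x s * x1 s - b\<^sup>2 * z s * z1 s) / metric_G s"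
  define u where "u = metric_E s / metric_G s"
  define v where "v = 1 / metric_G s"
  have K: "(nu_scale has_real_derivative - nu_scale s * (A + B)) (at s)" using nu_scale_deriv[OF s] unfolding A_def B_def .
  have g: "metric_E s * christoffel s = A - B" using nz unfolding christoffel_def A_def B_def by simp
  have X2: "x2 s = u * x s + (A - B) * x1 s" and Z2: "z2 s = u * b\<^sup>2 * z s + (A - B) * z1 s"
    using profile_equations[OF s] unfolding g[symmetric] u_def by (simp_all add: algebra_simps)
  have B: "B = v * (x s * x1 s - b\<^sup>2 * z s * z1 s)" and u: "u = v * metric_E s" and v: "v * metric_G s = 1"
    using nz by (simp_all add: B_def u_def v_def)
  have omega: "omega s * nu_scale s = v" using nz by (simp add: omega_def v_def)
  have E: "metric_E s = (x1 s)\<^sup>2 - (z1 s)\<^sup>2" and G: "metric_G s = (x s)\<^sup>2 - c\<^sup>2 * (z s)\<^sup>2"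
    by (simp_all add: metric_E_def metric_G_def c)
  have p: "- (A + B) * wronskian c s + (x s * z2 s + x1 s * z1 s - c * (z s * x2 s + z1 s * x1 s))
      = (1 + c) * v * (c * z s * z1 s - x s * x1 s) * wronskian c s"
    using v unfolding X2 Z2 B u E G wronskian_def c[symmetric] by algebra
  have dd: "- (A + B) * (c * z s * z1 s - x s * x1 s)
       + (c * (z s * z2 s + z1 s * z1 s) - (x s * x2 s + x1 s * x1 s))
      = (1 + c) * v * (wronskian c s)\<^sup>2"
    using v unfolding X2 Z2 B u E G wronskian_def c[symmetric] by algebra
  have "(nu_rot c has_real_derivative nu_scale s / 2 * (- (A + B) * wronskian c s
      + (x s * z2 s + x1 s * z1 s - c * (z s * x2 s + z1 s * x1 s)))) (at s)"
    unfolding nu_rot_def[abs_def] wronskian_def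
    by (rule derivative_eq_intros K d refl | simp)+ (simp add: field_simps)
  moreover have "nu_scale s / 2 * ((1 + c) * v * (c * z s * z1 s - x s * x1 s) * wronskian c s)
      = (1 + c) * omega s * nu_const c s * nu_rot c s"
    unfolding omega[symmetric] nu_const_def nu_rot_def by simp
  ultimately show "(nu_rot c has_real_derivative (1 + c) * omega s * nu_const c s * nu_rot c s) (at s)"
    unfolding p by (rule DERIV_cong)
  have "(nu_const c has_real_derivative nu_scale s * (- (A + B) * (c * z s * z1 s - x s * x1 s)
       + (c * (z s * z2 s + z1 s * z1 s) - (x s * x2 s + x1 s * x1 s)))) (at s)"
    unfolding nu_const_def[abs_def]
    by (rule derivative_eq_intros K d refl | simp)+ (simp add: field_simps)
  moreover have "nu_scale s * ((1 + c) * v * (wronskian c s)\<^sup>2) = 4 * (1 + c) * omega s * (nu_rot c s)\<^sup>2"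
    unfolding omega[symmetric] nu_rot_def by (simp add: power_divide power2_eq_square)
  ultimately show "(nu_const c has_real_derivative 4 * (1 + c) * omega s * (nu_rot c s)\<^sup>2) (at s)"
    unfolding dd by (rule DERIV_cong)
qed

text \<open>Common shape of the two halves: a component along the fixed \<open>J\<close> and one
  rotating in the plane of \<open>A\<close> and \<open>B\<close>. The values c = b and c = -b give
  the frequencies 1 + b and 1 - b.\<close>

definition half_map :: "real \<Rightarrow> 'a::real_normed_vector \<Rightarrow> 'a \<Rightarrow> 'a \<Rightarrow> real \<times> real \<Rightarrow> 'a" where
  "half_map c J A B p = (nu_const c (fst p) / 2) *\<^sub>R J + nu_rot c (fst p) *\<^sub>R rotating (1 + c) A B (snd p)"

text \<open>Second derivatives in tau come from the closed first order system. In the rotating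
  component the quadric relation replaces D^2 by \<open>metric_sign\<close> + 4 P^2, and the
  constant part cancels the contribution of the t-derivatives, so both components get the same
  factor.\<close>

lemma half_map_jet:
  assumes F: "F = half_map c J A B" and c: "c\<^sup>2 = b\<^sup>2"
  shows "\<exists>Fs Ft Fss Fst Ftt. second_order_jet U F Fs Ft Fss Fst Ftt \<and>
    (\<forall>p\<in>U. christoffel (fst p) *\<^sub>R Fs p - (1 / metric_E (fst p)) *\<^sub>R Fss p - (1 / metric_G (fst p)) *\<^sub>R Ftt p
       = half_eigenvalue c (fst p) *\<^sub>R F p)"
proof -
  \<comment> \<open>\<open>D1\<close>, \<open>D2\<close> are the first and second derivatives of
    half of \<open>nu_const\<close>, and \<open>P1\<close>, \<open>P2\<close> those of
    \<open>nu_rot\<close>. The first summands of \<open>D2\<close> and \<open>P2\<close> cancel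
    against the first order term of the Laplacian.\<close>
  define D1 where "D1 s = 2 * (1 + c) * omega s * (nu_rot c s)\<^sup>2" for s
  define D2 where "D2 s = D1 s * (metric_E s * christoffel s) + 4 * (1 + c)\<^sup>2 * (omega s)\<^sup>2 * nu_const c s * (nu_rot c s)\<^sup>2" for s
  define P1 where "P1 s = (1 + c) * omega s * nu_const c s * nu_rot c s" for s
  define P2 where "P2 s = P1 s * (metric_E s * christoffel s)
     + (1 + c)\<^sup>2 * (omega s)\<^sup>2 * (4 * (nu_rot c s)\<^sup>2 + (nu_const c s)\<^sup>2) * nu_rot c s" for s
  have dD: "((\<lambda>s. nu_const c s / 2) has_real_derivative D1 s) (at s)"
    and dP: "(nu_rot c has_real_derivative P1 s) (at s)"
    and dD1: "(D1 has_real_derivative D2 s) (at s)" and dP1: "(P1 has_real_derivative P2 s) (at s)"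
    if "s \<in> I" for s
  proof -
    note d = omega_deriv[OF that] nu_coefficients_deriv[OF that c]
    show "((\<lambda>s. nu_const c s / 2) has_real_derivative D1 s) (at s)"
      unfolding D1_def by (rule derivative_eq_intros d refl | simp)+
    show "(nu_rot c has_real_derivative P1 s) (at s)" unfolding P1_def by (rule d)
    show "(D1 has_real_derivative D2 s) (at s)"
      unfolding D1_def[abs_def] D2_def
      by (rule derivative_eq_intros d refl)+ (simp add: power2_eq_square algebra_simps)
    show "(P1 has_real_derivative P2 s) (at s)"
      unfolding P1_def[abs_def] P2_def
      by (rule derivative_eq_intros d refl)+ (simp add: power2_eq_square algebra_simps)
  qed
  \<comment> \<open>The fixed direction is treated as rotating with frequency 0.\<close>
  have J: "rotating 0 J 0 t = J" for t by (simp add: rotating_def)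
  note jet = second_order_jet_add[OF second_order_jet_rotating[of I _ _ _ "{0<..<2 * pi}", OF dD dD1]
      second_order_jet_rotating[of I _ _ _ "{0<..<2 * pi}", OF dP dP1], folded rot_domain_def, of 0 J 0 "1 + c" A B]
  show ?thesis
    unfolding F
  proof (intro exI conjI ballI)
    show "second_order_jet U (half_map c J A B)
     (\<lambda>p. D1 (fst p) *\<^sub>R J + P1 (fst p) *\<^sub>R rotating (1 + c) A B (snd p))
     (\<lambda>p. nu_rot c (fst p) *\<^sub>R (1 + c) *\<^sub>R rotating (1 + c) B (- A) (snd p))
     (\<lambda>p. D2 (fst p) *\<^sub>R J + P2 (fst p) *\<^sub>R rotating (1 + c) A B (snd p))
     (\<lambda>p. P1 (fst p) *\<^sub>R (1 + c) *\<^sub>R rotating (1 + c) B (- A) (snd p))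
     (\<lambda>p. nu_rot c (fst p) *\<^sub>R - ((1 + c)\<^sup>2) *\<^sub>R rotating (1 + c) A B (snd p))"
      using jet unfolding half_map_def[abs_def] by (simp add: J)
  next
    fix p assume "p \<in> U"
    then have s: "fst p \<in> I" by (auto simp: rot_domain_def)
    define s where "s = fst p"
    have nz: "metric_E s \<noteq> 0" "metric_G s \<noteq> 0" using s metric_E_nz metric_G_nz s_def by auto
    define e g where "e = 1 / metric_E s" and "g = 1 / metric_G s"
    have e: "e * metric_E s = 1" using nz by (simp add: e_def)
    have dls: "(metric_sign s)\<^sup>2 = 1" using metric_sign_sq[OF s] by (simp add: s_def)
    have o: "e * (omega s)\<^sup>2 = metric_sign s * g" using omega_sq[OF s] nz by (simp add: s_def e_def g_def)
    have m: "half_eigenvalue c s = - 8 * (1 + c)\<^sup>2 * metric_sign s * (nu_rot c s)\<^sup>2 * g" using half_eigenvalue_eq[OF s] by (simp add: s_def g_def)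
    have "christoffel s * D1 s - e * D2 s = half_eigenvalue c s * (nu_const c s / 2)"
    proof -
      have "christoffel s * D1 s - e * D2 s = christoffel s * D1 s * (1 - e * metric_E s) - 4 * (1 + c)\<^sup>2 * (e * (omega s)\<^sup>2) * nu_const c s * (nu_rot c s)\<^sup>2"
        unfolding D2_def by (simp add: algebra_simps)
      then show ?thesis unfolding e o m by simp
    qed
    moreover have "christoffel s * P1 s - e * P2 s + g * ((1 + c)\<^sup>2 * nu_rot c s) = half_eigenvalue c s * nu_rot c s"
    proof -
      have "christoffel s * P1 s - e * P2 s = christoffel s * P1 s * (1 - e * metric_E s) - (1 + c)\<^sup>2 * (e * (omega s)\<^sup>2) * (4 * (nu_rot c s)\<^sup>2 + (nu_const c s)\<^sup>2) * nu_rot c s"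
        unfolding P2_def by (simp add: algebra_simps)
      then have "christoffel s * P1 s - e * P2 s = - (1 + c)\<^sup>2 * (metric_sign s * g) * (4 * (nu_rot c s)\<^sup>2 + (nu_const c s)\<^sup>2) * nu_rot c s"
        unfolding e o by simp
      then show ?thesis
        using dls unfolding m nu_coefficients_quadric[OF c] by algebra
    qed
    ultimately have "half_eigenvalue c s *\<^sub>R half_map c J A B p =
       (christoffel s * D1 s - e * D2 s) *\<^sub>R J + (christoffel s * P1 s - e * P2 s + g * ((1 + c)\<^sup>2 * nu_rot c s)) *\<^sub>R rotating (1 + c) A B (snd p)"
      by (simp add: half_map_def s_def scaleR_add_right)
    also have "\<dots> = christoffel s *\<^sub>R (D1 s *\<^sub>R J + P1 s *\<^sub>R rotating (1 + c) A B (snd p))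
       - e *\<^sub>R (D2 s *\<^sub>R J + P2 s *\<^sub>R rotating (1 + c) A B (snd p))
       - g *\<^sub>R (nu_rot c s *\<^sub>R - ((1 + c)\<^sup>2) *\<^sub>R rotating (1 + c) A B (snd p))"
      by (simp add: scaleR_add_left scaleR_diff_left scaleR_add_right)
    finally show "christoffel (fst p) *\<^sub>R (D1 (fst p) *\<^sub>R J + P1 (fst p) *\<^sub>R rotating (1 + c) A B (snd p))
       - (1 / metric_E (fst p)) *\<^sub>R (D2 (fst p) *\<^sub>R J + P2 (fst p) *\<^sub>R rotating (1 + c) A B (snd p))
       - (1 / metric_G (fst p)) *\<^sub>R (nu_rot c (fst p) *\<^sub>R - ((1 + c)\<^sup>2) *\<^sub>R rotating (1 + c) A B (snd p))
       = half_eigenvalue c (fst p) *\<^sub>R half_map c J A B p"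
      by (simp add: s_def e_def g_def)
  qed
qed

end

section \<open>The Gauss map\<close>

lemma cos_sin_mult_zero:
  fixes c t :: real
  assumes "c * cos t = 0" and "c * sin t = 0"
  shows "c = 0"
proof -
  have "c = c * cos t * cos t + c * sin t * sin t"
    using sin_cos_squared_add[of t] by algebra
  then show ?thesis using assms by simp
qed

lemma bivectorsD: "A \<in> bivectors \<Longrightarrow> A $ i $ j = - (A $ j $ i)"
  unfolding bivectors_def by blast

lemma bivectorsI: "(\<And>i j. A $ i $ j = - (A $ j $ i)) \<Longrightarrow> A \<in> bivectors"
  unfolding bivectors_def by blast

lemma bivectors_eq_0:
  assumes "A \<in> bivectors" and "A $ 1 $ 2 = 0" "A $ 1 $ 3 = 0" "A $ 1 $ 4 = 0"
    "A $ 2 $ 3 = 0" "A $ 2 $ 4 = 0" "A $ 3 $ 4 = 0"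
  shows "A = 0"
proof -
  note a = bivectorsD[OF assms(1)]
  have "A $ i $ i = 0" for i using a[of i i] by linarith
  moreover have "A $ 2 $ 1 = 0" "A $ 3 $ 1 = 0" "A $ 4 $ 1 = 0" "A $ 3 $ 2 = 0" "A $ 4 $ 2 = 0" "A $ 4 $ 3 = 0"
    using a[of 2 1] a[of 3 1] a[of 4 1] a[of 3 2] a[of 4 2] a[of 4 3] assms(2-) by simp_all
  ultimately show ?thesis using assms(2-) by (simp add: vec_eq_iff forall_4)
qed

lemma bivectors_add:
  assumes "A \<in> bivectors" and "B \<in> bivectors"
  shows "A + B \<in> bivectors"
proof (rule bivectorsI)
  show "(A + B) $ i $ j = - ((A + B) $ j $ i)" for i j
    using bivectorsD[OF assms(1), of i j] bivectorsD[OF assms(2), of i j] by simp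
qed

lemma bivectors_scaleR:
  assumes "A \<in> bivectors"
  shows "c *\<^sub>R A \<in> bivectors"
proof (rule bivectorsI)
  show "(c *\<^sub>R A) $ i $ j = - ((c *\<^sub>R A) $ j $ i)" for i j
    using bivectorsD[OF assms, of i j] by simp
qed

lemma bivectors_uminus: "A \<in> bivectors \<Longrightarrow> - A \<in> bivectors"
  using bivectors_scaleR[of A "- 1"] by simp

lemma wedge_bivectors: "wedge u v \<in> bivectors"
  by (rule bivectorsI) (simp add: wedge_def)

lemma continuous_on_wedge:
  assumes "continuous_on S f" and "continuous_on S g"
  shows "continuous_on S (\<lambda>p. wedge (f p) (g p))"
  unfolding wedge_def by (intro continuous_intros assms)

lemma wedge_combination:
  "wedge (a *\<^sub>R u + c *\<^sub>R v) (a' *\<^sub>R u + c' *\<^sub>R v) = (a * c' - a' * c) *\<^sub>R wedge u v"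
  by (simp add: wedge_def vec_eq_iff algebra_simps)

section \<open>Splitting of the Gauss map into its two halves\<close>

context minimal_profile
begin

text \<open>The three constant bivectors form a basis of the anti-self-dual ones. Rotation by t in
  the first plane and bt in the second fixes the first of them and turns the other two by (1 + b)
  t.\<close>

definition nu_minus :: "real \<times> real \<Rightarrow> real ^ 4 ^ 4" where
  "nu_minus = half_map b (wedge (axis 1 1) (axis 2 1) - wedge (axis 3 1) (axis 4 1))
     (wedge (axis 1 1) (axis 4 1) + wedge (axis 2 1) (axis 3 1))
     (wedge (axis 2 1) (axis 4 1) - wedge (axis 1 1) (axis 3 1))"

text \<open>The same for the self-dual bivectors, which turn by (1 - b) t.\<close>

definition nu_plus :: "real \<times> real \<Rightarrow> real ^ 4 ^ 4" where
  "nu_plus = half_map (- b) (- wedge (axis 1 1) (axis 2 1) - wedge (axis 3 1) (axis 4 1))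
     (wedge (axis 1 1) (axis 4 1) - wedge (axis 2 1) (axis 3 1))
     (wedge (axis 2 1) (axis 4 1) + wedge (axis 1 1) (axis 3 1))"

lemma nu_minus_nth:
  "nu_minus p $ 1 $ 2 = nu_const b (fst p) / 2" "nu_minus p $ 3 $ 4 = - nu_const b (fst p) / 2"
  "nu_minus p $ 1 $ 4 = nu_rot b (fst p) * cos ((1 + b) * snd p)"
  "nu_minus p $ 2 $ 3 = nu_rot b (fst p) * cos ((1 + b) * snd p)"
  "nu_minus p $ 2 $ 4 = nu_rot b (fst p) * sin ((1 + b) * snd p)"
  "nu_minus p $ 1 $ 3 = - nu_rot b (fst p) * sin ((1 + b) * snd p)"
  by (simp_all add: nu_minus_def half_map_def rotating_def wedge_def axis_def)

lemma nu_plus_nth: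
  "nu_plus p $ 1 $ 2 = - nu_const (- b) (fst p) / 2" "nu_plus p $ 3 $ 4 = - nu_const (- b) (fst p) / 2"
  "nu_plus p $ 1 $ 4 = nu_rot (- b) (fst p) * cos ((1 - b) * snd p)"
  "nu_plus p $ 2 $ 3 = - nu_rot (- b) (fst p) * cos ((1 - b) * snd p)"
  "nu_plus p $ 2 $ 4 = nu_rot (- b) (fst p) * sin ((1 - b) * snd p)"
  "nu_plus p $ 1 $ 3 = nu_rot (- b) (fst p) * sin ((1 - b) * snd p)"
  by (simp_all add: nu_plus_def half_map_def rotating_def wedge_def axis_def)

lemma half_map_bivectors:
  assumes "J \<in> bivectors" and "A \<in> bivectors" and "B \<in> bivectors"
  shows "half_map c J A B p \<in> bivectors"
  unfolding half_map_def rotating_def by (intro bivectors_add bivectors_scaleR assms)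

lemma nu_bivectors: "nu_minus p \<in> bivectors" "nu_plus p \<in> bivectors"
  unfolding nu_minus_def nu_plus_def diff_conv_add_uminus
  by (intro half_map_bivectors bivectors_add bivectors_uminus wedge_bivectors)+

text \<open>Exchanging the coefficients of \<open>rs\<close> on \<open>frame1\<close> and
  \<open>frame3\<close>, and those of \<open>rt\<close> on \<open>frame2\<close> and
  \<open>frame4\<close> (for \<open>normal4\<close>), gives orthogonal normal fields with squares -E
  and -G.\<close>

definition normal3 where "normal3 p = z1 (fst p) *\<^sub>R frame1 (snd p) + x1 (fst p) *\<^sub>R frame3 b (snd p)"
definition normal4 where "normal4 p = (b * z (fst p)) *\<^sub>R frame2 (snd p) + x (fst p) *\<^sub>R frame4 b (snd p)"

text \<open>The addition theorems split the products of functions of t and bt into terms of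
  frequency 1 + b and 1 - b.\<close>

lemma wedge_normals: "nu_scale (fst p) *\<^sub>R wedge (normal3 p) (normal4 p) = nu_minus p + nu_plus p"
proof -
  have t: "sin (snd p) * sin (snd p) = 1 - cos (snd p) * cos (snd p)"
    "sin (b * snd p) * sin (b * snd p) = 1 - cos (b * snd p) * cos (b * snd p)"
    using sin_cos_squared_add[of "snd p"] sin_cos_squared_add[of "b * snd p"]
    by (simp_all add: power2_eq_square)
  have "nu_scale (fst p) *\<^sub>R wedge (normal3 p) (normal4 p) + - (nu_minus p + nu_plus p) = 0"
    by (rule bivectors_eq_0, intro bivectors_add bivectors_scaleR bivectors_uminus wedge_bivectors nu_bivectors)
       (simp_all add: wedge_def normal3_def normal4_def frame_nth nu_minus_nth nu_plus_nth distrib_right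
          left_diff_distrib cos_add sin_add cos_diff sin_diff nu_rot_def nu_const_def wronskian_def field_simps,
        (use t in algebra)+)
  then show ?thesis by (simp only: add_uminus_conv_diff right_minus_eq)
qed

text \<open>The halves lie in complementary spaces, and neither vanishes: by the quadric relation
  \<open>nu_const\<close> and \<open>nu_rot\<close> have no common zero.\<close>

lemma nu_independent:
  assumes p: "p \<in> U" and 0: "\<alpha> *\<^sub>R nu_minus p + \<beta> *\<^sub>R nu_plus p = 0"
  shows "\<alpha> = 0" and "\<beta> = 0"
proof -
  have s: "fst p \<in> I" using p by (auto simp: rot_domain_def)
  have "(\<alpha> *\<^sub>R nu_minus p + \<beta> *\<^sub>R nu_plus p) $ i $ j = 0" for i j using 0 by simp
  then have e: "\<alpha> * nu_minus p $ i $ j + \<beta> * nu_plus p $ i $ j = 0" for i j by simp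
  note e = e[of 1 2, unfolded nu_minus_nth nu_plus_nth] e[of 3 4, unfolded nu_minus_nth nu_plus_nth]
    e[of 1 4, unfolded nu_minus_nth nu_plus_nth] e[of 2 3, unfolded nu_minus_nth nu_plus_nth]
    e[of 2 4, unfolded nu_minus_nth nu_plus_nth] e[of 1 3, unfolded nu_minus_nth nu_plus_nth]
  have key: "a = 0" if "a * nu_const c (fst p) = 0" "a * (nu_rot c (fst p) * cos t) = 0"
    "a * (nu_rot c (fst p) * sin t) = 0" "c\<^sup>2 = b\<^sup>2" for a c t
  proof -
    have "a * nu_rot c (fst p) = 0"
      using cos_sin_mult_zero[of "a * nu_rot c (fst p)" t] that(2,3) by (simp add: mult.assoc)
    moreover have "a * metric_sign (fst p) = (a * nu_const c (fst p)) * nu_const c (fst p) - 4 * ((a * nu_rot c (fst p)) * nu_rot c (fst p))"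
      using nu_coefficients_quadric[OF that(4), of "fst p"] by algebra
    ultimately have "a * metric_sign (fst p) = 0" using that(1) by simp
    then show ?thesis using metric_sign_sq[OF s] by auto
  qed
  show "\<alpha> = 0"
    by (rule key[of _ b "(1 + b) * snd p"]) (use e in \<open>linarith+\<close>)
  show "\<beta> = 0"
    by (rule key[of _ "- b" "(1 - b) * snd p"]) (use e in \<open>linarith | simp\<close>)+
qed

lemma nu_nonzero: "p \<in> U \<Longrightarrow> nu_minus p + nu_plus p \<noteq> 0"
  using nu_independent(1)[of p 1 1] by auto

lemma normal_combination:
  assumes s: "fst p \<in> I" and "ip y (rs p) = 0" and "ip y (rt p) = 0"
  shows "\<exists>a c. y = a *\<^sub>R normal3 p + c *\<^sub>R normal4 p"
proof -
  define y1 y2 y3 y4 where y: "y1 = ip y (frame1 (snd p))" "y2 = ip y (frame2 (snd p))"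
    "y3 = - ip y (frame3 b (snd p))" "y4 = - ip y (frame4 b (snd p))"
  have Y: "y = y1 *\<^sub>R frame1 (snd p) + y2 *\<^sub>R frame2 (snd p) + y3 *\<^sub>R frame3 b (snd p) + y4 *\<^sub>R frame4 b (snd p)"
    using frame_expansion[of y "snd p" b] by (simp add: y)
  \<comment> \<open>Products of \<open>y\<close> with \<open>normal3\<close> and
    \<open>normal4\<close>, divided by their squares -E and -G.\<close>
  define a c where ac: "a = (x1 (fst p) * y3 - z1 (fst p) * y1) / metric_E (fst p)"
    "c = (x (fst p) * y4 - b * z (fst p) * y2) / metric_G (fst p)"
  have o: "x1 (fst p) * y1 - z1 (fst p) * y3 = 0" "x (fst p) * y2 - b * z (fst p) * y4 = 0"
    using assms(2,3) by (simp_all add: rs_def rt_def ip_linear y)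
  have "a * metric_E (fst p) = x1 (fst p) * y3 - z1 (fst p) * y1"
    "c * metric_G (fst p) = x (fst p) * y4 - b * z (fst p) * y2"
    using metric_E_nz[OF s] metric_G_nz[OF s] by (simp_all add: ac)
  then have "metric_E (fst p) * y1 = metric_E (fst p) * (a * z1 (fst p))" "metric_E (fst p) * y3 = metric_E (fst p) * (a * x1 (fst p))"
    "metric_G (fst p) * y2 = metric_G (fst p) * (c * (b * z (fst p)))" "metric_G (fst p) * y4 = metric_G (fst p) * (c * x (fst p))"
    using o unfolding metric_E_def metric_G_def by algebra+
  then have "y1 = a * z1 (fst p)" "y3 = a * x1 (fst p)" "y2 = c * (b * z (fst p))" "y4 = c * x (fst p)"
    using metric_E_nz[OF s] metric_G_nz[OF s] by simp_all
  then have "y = a *\<^sub>R normal3 p + c *\<^sub>R normal4 p"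
    unfolding Y normal3_def normal4_def by (simp add: scaleR_add_right)
  then show ?thesis by blast
qed

text \<open>The coefficient determinant of \<open>E 1\<close>, \<open>E 2\<close> in terms of
  \<open>rs\<close>, \<open>rt\<close> is nonzero by \<open>frame_trace\<close>, so orthogonality to
  the former pair carries over to the latter.\<close>

lemma frame_normal:
  assumes fr: "adapted_frame r U X E" and p: "p \<in> U" and i: "i \<in> {3, 4}"
  shows "ip (E i p) (rs p) = 0" and "ip (E i p) (rt p) = 0"
proof -
  have s: "fst p \<in> I" using p by (auto simp: rot_domain_def)
  obtain rst where rj: "second_order_jet U r rs rt rss rst rtt" using surface_jet by blast
  obtain a1 c1 where X1: "X 1 p = (a1, c1)" by fastforce
  obtain a2 c2 where X2: "X 2 p = (a2, c2)" by fastforce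
  have E1: "E 1 p = a1 *\<^sub>R rs p + c1 *\<^sub>R rt p" and E2: "E 2 p = a2 *\<^sub>R rs p + c2 *\<^sub>R rt p"
    using adapted_frame_tangent(2)[OF fr p, of 1] adapted_frame_tangent(2)[OF fr p, of 2]
    by (simp_all add: deriv_along_jet[OF rj p] X1[unfolded One_nat_def] X2)
  have e: "ip (E 1 p) (E 1 p) \<in> {1, -1}" "ip (E 2 p) (E 2 p) \<in> {1, -1}" "ip (E 1 p) (E 2 p) = 0"
    by (intro adapted_frameD[OF fr p]; simp)+
  have o': "ip (rt p) (rs p) = 0" using ip_tangent(3) by (simp add: ip_commute)
  have "(a1 * c2 - a2 * c1)\<^sup>2 * (metric_E (fst p) * metric_G (fst p)) = ip (E 1 p) (E 1 p) * ip (E 2 p) (E 2 p)"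
    by (rule frame_trace(1)[OF _ _ _ e(1,2)])
       (use e(3) in \<open>simp_all add: E1[unfolded One_nat_def] E2 ip_linear ip_tangent o' power2_eq_square ac_simps\<close>)
  then have d: "a1 * c2 - a2 * c1 \<noteq> 0" using e by auto
  have "ip (E i p) (E 1 p) = 0" "ip (E i p) (E 2 p) = 0"
    using i by (auto intro!: adapted_frameD(3)[OF fr p])
  then have "a1 * ip (E i p) (rs p) + c1 * ip (E i p) (rt p) = 0"
    "a2 * ip (E i p) (rs p) + c2 * ip (E i p) (rt p) = 0"
    unfolding E1 E2 ip_linear by auto
  then have "(a1 * c2 - a2 * c1) * ip (E i p) (rs p) = 0" "(a1 * c2 - a2 * c1) * ip (E i p) (rt p) = 0"
    by algebra+
  then show "ip (E i p) (rs p) = 0" and "ip (E i p) (rt p) = 0" using d by auto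
qed

text \<open>Applied to the normal plane, \<open>frame_trace\<close> shows that the determinant
  \<open>d\<close> of the change from \<open>normal3\<close>, \<open>normal4\<close> to
  \<open>E 3\<close>, \<open>E 4\<close> satisfies d^2 E G = 1 or -1, so |d| =
  \<open>nu_scale\<close>.\<close>

lemma gauss_map_pointwise:
  assumes fr: "adapted_frame r U X E" and p: "p \<in> U"
  shows "\<exists>\<sigma>\<in>{1, -1}. gauss_map E p = \<sigma> *\<^sub>R (nu_minus p + nu_plus p)"
proof -
  have s: "fst p \<in> I" using p by (auto simp: rot_domain_def)
  obtain a3 c3 where E3: "E 3 p = a3 *\<^sub>R normal3 p + c3 *\<^sub>R normal4 p"
    using normal_combination[OF s frame_normal[OF fr p, of 3]] by auto
  obtain a4 c4 where E4: "E 4 p = a4 *\<^sub>R normal3 p + c4 *\<^sub>R normal4 p"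
    using normal_combination[OF s frame_normal[OF fr p, of 4]] by auto
  have e: "ip (E 3 p) (E 3 p) \<in> {1, -1}" "ip (E 4 p) (E 4 p) \<in> {1, -1}" "ip (E 3 p) (E 4 p) = 0"
    by (intro adapted_frameD[OF fr p]; simp)+
  have n: "ip (normal3 p) (normal3 p) = - metric_E (fst p)" "ip (normal4 p) (normal4 p) = - metric_G (fst p)"
    "ip (normal3 p) (normal4 p) = 0" "ip (normal4 p) (normal3 p) = 0"
    by (simp_all add: normal3_def normal4_def ip_linear ip_frame metric_E_def metric_G_def power2_eq_square)
  define d where "d = a3 * c4 - a4 * c3"
  have "d\<^sup>2 * (- metric_E (fst p) * - metric_G (fst p)) = ip (E 3 p) (E 3 p) * ip (E 4 p) (E 4 p)"
    unfolding d_def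
    by (rule frame_trace(1)[OF _ _ _ e(1,2)])
       (use e(3) in \<open>simp_all add: E3 E4 ip_linear n power2_eq_square ac_simps\<close>)
  then have "(d\<^sup>2 * (metric_E (fst p) * metric_G (fst p)))\<^sup>2 = 1" using e by auto
  then have "(d\<^sup>2)\<^sup>2 = ((nu_scale (fst p))\<^sup>2)\<^sup>2"
    using nu_scale_pow4[OF s] by algebra
  then have "d\<^sup>2 = (nu_scale (fst p))\<^sup>2" by (rule power2_eq_imp_eq) simp_all
  then have "d / nu_scale (fst p) \<in> {1, -1}" using nu_scale_pos[OF s] by (auto simp: power2_eq_iff)
  moreover have "gauss_map E p = (d / nu_scale (fst p)) *\<^sub>R (nu_minus p + nu_plus p)"
    unfolding gauss_map_def E3 E4 wedge_combination wedge_normals[symmetric] d_def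
    using nu_scale_pos[OF s] by simp
  ultimately show ?thesis by blast
qed

lemma gauss_map_eq:
  assumes fr: "adapted_frame r U X E"
  obtains \<sigma> where "\<sigma> \<in> {1, -1 :: real}" and "\<forall>p\<in>U. gauss_map E p = \<sigma> *\<^sub>R (nu_minus p + nu_plus p)"
proof -
  let ?nu = "\<lambda>p. nu_minus p + nu_plus p"
  \<comment> \<open>The Euclidean inner product exhibits the sign as a continuous function; with
    values in a finite set it is constant on the connected domain.\<close>
  define g where "g p = inner (gauss_map E p) (?nu p) / inner (?nu p) (?nu p)" for p
  have g: "g p \<in> {1, -1} \<and> gauss_map E p = g p *\<^sub>R ?nu p" if p: "p \<in> U" for p
  proof -
    obtain \<sigma> where \<sigma>: "\<sigma> \<in> {1, -1}" "gauss_map E p = \<sigma> *\<^sub>R ?nu p"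
      using gauss_map_pointwise[OF fr p] by blast
    then have "g p = \<sigma>"
      unfolding g_def \<sigma>(2) inner_scaleR_left using nu_nonzero[OF p] by simp
    then show ?thesis using \<sigma> by simp
  qed
  have half: "continuous_on U (half_map c J A B)" if c: "c\<^sup>2 = b\<^sup>2" for c and J A B :: "real ^ 4 ^ 4"
  proof -
    obtain Fs Ft Fss Fst Ftt where "second_order_jet U (half_map c J A B) Fs Ft Fss Fst Ftt"
      using half_map_jet[OF refl c] by blast
    then show ?thesis
      unfolding second_order_jet_def
      by (intro continuous_at_imp_continuous_on ballI) (blast intro: has_derivative_continuous)
  qed
  have nu: "continuous_on U ?nu"
    unfolding nu_minus_def nu_plus_def by (intro continuous_on_add half) simp_all
  have "continuous_on U (E i)" if "i \<in> {1..4}" for i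
  proof (cases "U = {}")
    case False
    then show ?thesis
      using adapted_frameD(1)[OF fr _ that] unfolding smooth_on_def by (metis diff_order_on.simps(1) ex_in_conv)
  qed simp
  then have G: "continuous_on U (gauss_map E)"
    unfolding gauss_map_def[abs_def] by (intro continuous_on_wedge) simp_all
  have "continuous_on U g"
    unfolding g_def[abs_def]
    by (intro continuous_on_divide continuous_on_inner nu G) (use nu_nonzero in simp)
  moreover have "connected U"
    unfolding rot_domain_def using interval_I by (intro connected_Times is_interval_connected) auto
  moreover have "finite (g ` U)"
    by (rule finite_subset[of _ "{1, -1}"]) (use g in auto)
  ultimately have "g constant_on U" by (intro continuous_finite_range_constant)
  then obtain \<sigma> where \<sigma>: "\<And>p. p \<in> U \<Longrightarrow> g p = \<sigma>" unfolding constant_on_def by blast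
  obtain s where "s \<in> I" using nonempty_I by blast
  then have "(s, pi) \<in> U" by (simp add: rot_domain_def)
  then have "\<sigma> \<in> {1, -1}" using g \<sigma> by metis
  then show thesis using that g \<sigma> by metis
qed

lemma laplacian_gauss_map:
  assumes fr: "adapted_frame r U X E" and p: "p \<in> U"
    and \<sigma>: "\<forall>p\<in>U. gauss_map E p = \<sigma> *\<^sub>R (nu_minus p + nu_plus p)"
  shows "laplacian r X E (gauss_map E) p
    = \<sigma> *\<^sub>R (half_eigenvalue b (fst p) *\<^sub>R nu_minus p + half_eigenvalue (- b) (fst p) *\<^sub>R nu_plus p)"
proof -
  obtain Fs Ft Fss Fst Ftt where F: "second_order_jet U nu_minus Fs Ft Fss Fst Ftt"
    and LF: "\<forall>p\<in>U. christoffel (fst p) *\<^sub>R Fs p - (1 / metric_E (fst p)) *\<^sub>R Fss p - (1 / metric_G (fst p)) *\<^sub>R Ftt p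
       = half_eigenvalue b (fst p) *\<^sub>R nu_minus p"
    using half_map_jet[OF nu_minus_def refl] by blast
  obtain Hs Ht Hss Hst Htt where H: "second_order_jet U nu_plus Hs Ht Hss Hst Htt"
    and LH: "\<forall>p\<in>U. christoffel (fst p) *\<^sub>R Hs p - (1 / metric_E (fst p)) *\<^sub>R Hss p - (1 / metric_G (fst p)) *\<^sub>R Htt p
       = half_eigenvalue (- b) (fst p) *\<^sub>R nu_plus p"
    using half_map_jet[OF nu_plus_def power2_minus] by blast
  have jet: "second_order_jet U (gauss_map E) (\<lambda>p. \<sigma> *\<^sub>R (Fs p + Hs p)) (\<lambda>p. \<sigma> *\<^sub>R (Ft p + Ht p))
    (\<lambda>p. \<sigma> *\<^sub>R (Fss p + Hss p)) (\<lambda>p. \<sigma> *\<^sub>R (Fst p + Hst p)) (\<lambda>p. \<sigma> *\<^sub>R (Ftt p + Htt p))"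
    by (rule second_order_jet_cong[OF second_order_jet_scaleR[OF second_order_jet_add[OF F H]] open_U])
       (simp add: \<sigma>)
  show ?thesis
    unfolding laplacian_eq[OF fr p jet] bspec[OF LF p, symmetric] bspec[OF LH p, symmetric]
    by (simp add: algebra_simps)
qed

end

section \<open>Surfaces of the second kind\<close>

lemma has_derivative_zero_interval:
  fixes f :: "real \<Rightarrow> real"
  assumes "is_interval I" and "\<And>s. s \<in> I \<Longrightarrow> (f has_real_derivative 0) (at s)"
  shows "\<exists>c. \<forall>s\<in>I. f s = c"
  using has_field_derivative_zero_constant[of I f] assms is_interval_convex
  by (blast intro: has_field_derivative_at_within)

text \<open>Integrating factor: f exp(-h) is constant when h' = g, and the exponential never
  vanishes.\<close>

lemma linear_ode_zero_segment:
  fixes f g :: "real \<Rightarrow> real"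
  assumes "\<And>s. s \<in> {a..b} \<Longrightarrow> (f has_real_derivative g s * f s) (at s)" and "continuous_on {a..b} g"
    and "a \<le> b"
  shows "f a = 0 \<longleftrightarrow> f b = 0"
proof -
  obtain h where h: "\<And>s. s \<in> {a..b} \<Longrightarrow> (h has_vector_derivative g s) (at s within {a..b})"
    using antiderivative_continuous[OF assms(2)] by blast
  have "((\<lambda>s. f s * exp (- h s)) has_real_derivative 0) (at s within {a..b})" if "s \<in> {a..b}" for s
  proof -
    have H: "(h has_real_derivative g s) (at s within {a..b})"
      using h[OF that] by (simp add: has_real_derivative_iff_has_vector_derivative)
    have F: "(f has_real_derivative g s * f s) (at s within {a..b})"
      using assms(1)[OF that] by (rule has_field_derivative_at_within)
    show ?thesis
      by (rule derivative_eq_intros F H refl)+ (simp add: algebra_simps)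
  qed
  then obtain c where "\<And>s. s \<in> {a..b} \<Longrightarrow> f s * exp (- h s) = c"
    using has_field_derivative_zero_constant[of "{a..b}" "\<lambda>s. f s * exp (- h s)"] by auto
  from this[of a] this[of b] \<open>a \<le> b\<close> show ?thesis by auto
qed

lemma linear_ode_zero:
  fixes f g :: "real \<Rightarrow> real"
  assumes I: "is_interval I" and f: "\<And>s. s \<in> I \<Longrightarrow> (f has_real_derivative g s * f s) (at s)"
    and g: "continuous_on I g" and s: "s \<in> I" "s' \<in> I" and "f s = 0"
  shows "f s' = 0"
proof -
  have "f a = 0 \<longleftrightarrow> f b = 0" if "a \<in> I" "b \<in> I" "a \<le> b" for a b
  proof -
    have "{a..b} \<subseteq> I" using I that by (meson atLeastAtMost_iff mem_is_interval_1_I subsetI)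
    then show ?thesis
      using f g that(3) by (intro linear_ode_zero_segment[of a b f g]) (auto intro: continuous_on_subset)
  qed
  from this[OF s] this[OF s(2,1)] show ?thesis using \<open>f s = 0\<close> by linarith
qed

lemma abs_powr_has_real_derivative:
  fixes f :: "real \<Rightarrow> real"
  assumes "(f has_real_derivative f') (at s)" and "f s \<noteq> 0"
  shows "((\<lambda>s. \<bar>f s\<bar> powr a) has_real_derivative a * \<bar>f s\<bar> powr a * (f' / f s)) (at s)"
proof -
  \<comment> \<open>Rewriting with the square makes the function differentiable without separating
    the signs of f.\<close>
  have sq: "\<bar>y\<bar> powr a = (y\<^sup>2) powr (a / 2)" for y :: real
    using powr_powr[of "\<bar>y\<bar>" 2 "a / 2"] by simp
  have d: "((\<lambda>s. (f s)\<^sup>2) has_real_derivative 2 * f s * f') (at s)"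
    by (rule derivative_eq_intros assms refl)+ simp
  have "((\<lambda>s. ((f s)\<^sup>2) powr (a / 2)) has_real_derivative (a / 2) * ((f s)\<^sup>2) powr (a / 2 - 1) * (2 * f s * f')) (at s)"
    by (rule DERIV_chain2[OF has_real_derivative_powr d]) (use assms(2) in simp)
  moreover have "(a / 2) * ((f s)\<^sup>2) powr (a / 2 - 1) * (2 * f s * f') = a * ((f s)\<^sup>2) powr (a / 2) * (f' / f s)"
  proof -
    have "((f s)\<^sup>2) powr (a / 2 - 1) = ((f s)\<^sup>2) powr (a / 2) / (f s)\<^sup>2"
      using assms(2) by (simp add: powr_diff)
    then show ?thesis using assms(2) by (simp add: power2_eq_square)
  qed
  ultimately show ?thesis unfolding sq by metis
qed

text \<open>The equation says that g |f|^(-a) has derivative 0.\<close>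

lemma power_curve:
  fixes f g f' g' :: "real \<Rightarrow> real"
  assumes I: "is_interval I" and nz: "\<And>s. s \<in> I \<Longrightarrow> f s \<noteq> 0"
    and f: "\<And>s. s \<in> I \<Longrightarrow> (f has_real_derivative f' s) (at s)"
    and g: "\<And>s. s \<in> I \<Longrightarrow> (g has_real_derivative g' s) (at s)"
    and eq: "\<And>s. s \<in> I \<Longrightarrow> f s * g' s = a * g s * f' s"
  shows "\<exists>c. \<forall>s\<in>I. g s = c * \<bar>f s\<bar> powr a"
proof -
  have "((\<lambda>s. g s * \<bar>f s\<bar> powr (- a)) has_real_derivative 0) (at s)" if s: "s \<in> I" for s
  proof -
    have "((\<lambda>s. g s * \<bar>f s\<bar> powr (- a)) has_real_derivative
        g' s * \<bar>f s\<bar> powr (- a) + (- a * \<bar>f s\<bar> powr (- a) * (f' s / f s)) * g s) (at s)"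
      by (rule DERIV_mult g abs_powr_has_real_derivative f nz s)+
    moreover have "g' s * \<bar>f s\<bar> powr (- a) + (- a * \<bar>f s\<bar> powr (- a) * (f' s / f s)) * g s
        = \<bar>f s\<bar> powr (- a) / f s * (f s * g' s - a * g s * f' s)"
      using nz[OF s] by (simp add: field_simps)
    ultimately show ?thesis using eq[OF s] by simp
  qed
  from has_derivative_zero_interval[OF I this]
  obtain c where c: "\<And>s. s \<in> I \<Longrightarrow> g s * \<bar>f s\<bar> powr (- a) = c" by auto
  have "g s = c * \<bar>f s\<bar> powr a" if "s \<in> I" for s
    using c[OF that] nz[OF that] by (auto simp: powr_minus field_simps)
  then show ?thesis by blast
qed

lemma trig_constants_zero:
  fixes k :: real
  assumes k: "k \<noteq> 0" and eq: "\<And>t. t \<in> {0<..<2 * pi} \<Longrightarrow> c2 * cos (k * t) = c1 * sin (k * t)"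
  shows "c1 = 0" and "c2 = 0"
proof -
  \<comment> \<open>The equation is tested at t = 1 and t = 1 + u. The determinant of the resulting
    linear system is sin(k u), nonzero because 0 < |k| u <= 1; both points lie in the
    interval.\<close>
  define u where "u = min 1 (1 / \<bar>k\<bar>)"
  have u: "0 < u" "u \<le> 1" "\<bar>k\<bar> * u \<le> 1"
    using k by (auto simp: u_def min_def field_simps)
  have "1 + u < 2 * pi" "1 < 2 * pi" using u pi_gt3 by linarith+
  then have 1: "c2 * cos (k * 1) = c1 * sin (k * 1)" and 2: "c2 * cos (k * (1 + u)) = c1 * sin (k * (1 + u))"
    using u eq[of 1] eq[of "1 + u"] by simp_all
  have "sin (\<bar>k\<bar> * u) > 0" using u k pi_gt3 by (intro sin_gt_zero) (auto intro: mult_pos_pos)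
  moreover have "\<bar>sin (k * u)\<bar> = \<bar>sin (\<bar>k\<bar> * u)\<bar>" by (cases "k \<ge> 0") simp_all
  ultimately have "sin (k * u) \<noteq> 0" by auto
  moreover have "sin (k * u) = sin (k * (1 + u)) * cos (k * 1) - cos (k * (1 + u)) * sin (k * 1)"
    by (simp add: distrib_left flip: sin_diff)
  ultimately have s: "sin (k * (1 + u)) * cos (k * 1) - cos (k * (1 + u)) * sin (k * 1) \<noteq> 0" by simp
  have "c1 * (sin (k * (1 + u)) * cos (k * 1) - cos (k * (1 + u)) * sin (k * 1)) = 0"
    "c2 * (sin (k * (1 + u)) * cos (k * 1) - cos (k * (1 + u)) * sin (k * 1)) = 0"
    using 1 2 by algebra+
  then show "c1 = 0" and "c2 = 0" using s by auto
qed

text \<open>Eliminating \<open>f\<close> from the rotating components leaves c2 cos(kt) = c1 sin(kt)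
  for all t, so c1 = c2 = 0. Those components then force f = \<alpha>, and the fixed component gives
  c0 = 0.\<close>

lemma half_rigid:
  fixes f :: "real \<Rightarrow> real"
  assumes nz: "\<alpha> \<noteq> 0" "D \<noteq> 0" "P \<noteq> 0" "k \<noteq> 0"
    and eq: "\<And>t. t \<in> {0<..<2 * pi} \<Longrightarrow> \<alpha> * D = f t * (D + c0)"
      "\<And>t. t \<in> {0<..<2 * pi} \<Longrightarrow> \<alpha> * (P * cos (k * t)) = f t * (P * cos (k * t) + c1)"
      "\<And>t. t \<in> {0<..<2 * pi} \<Longrightarrow> \<alpha> * (P * sin (k * t)) = f t * (P * sin (k * t) + c2)"
  shows "c0 = 0" "c1 = 0" "c2 = 0"
proof -
  have fnz: "f t \<noteq> 0" if "t \<in> {0<..<2 * pi}" for t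
    using eq(1)[OF that] nz by auto
  have "c2 * cos (k * t) = c1 * sin (k * t)" if "t \<in> {0<..<2 * pi}" for t
  proof -
    have "f t * (c2 * cos (k * t) - c1 * sin (k * t)) = 0"
      using eq(2,3)[OF that] by algebra
    then show ?thesis using fnz[OF that] by simp
  qed
  from trig_constants_zero[OF nz(4) this] show c: "c1 = 0" "c2 = 0" by auto
  have t: "pi \<in> {0<..<2 * pi}" by simp
  have "(\<alpha> - f pi) * P * cos (k * pi) = 0" "(\<alpha> - f pi) * P * sin (k * pi) = 0"
    using eq(2,3)[OF t] c by (simp_all add: algebra_simps)
  then have "\<alpha> = f pi" using nz(3) cos_sin_mult_zero[of "(\<alpha> - f pi) * P" "k * pi"] by simp
  then show "c0 = 0" using eq(1)[OF t] nz(1) by auto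
qed

text \<open>The profile stays on a line through the origin. For b = 1 the rotation is multiplication
  by e^(it) on C^2, which preserves the complex line spanned by (x0, z0); for z0 = 0 the surface
  stays in the first rotation plane.\<close>

lemma planarI:
  assumes nz: "x0 \<noteq> 0 \<or> z0 \<noteq> 0" and b: "b = 1 \<or> z0 = 0"
    and eq: "\<And>s. s \<in> I \<Longrightarrow> \<exists>l. x s = l * x0 \<and> z s = l * z0"
  shows "planar (rot_surface b x z) (rot_domain I)"
proof -
  define v1 :: "real ^ 4" where "v1 = vector [x0, 0, z0, 0]"
  define v2 :: "real ^ 4" where "v2 = vector [0, x0, 0, z0]"
  have n: "v1 \<noteq> 0" "v2 \<noteq> 0" using nz by (auto simp: v1_def v2_def vec_eq_iff forall_4 vector_4)
  have o: "inner v1 v2 = 0" by (simp add: v1_def v2_def inner_vec_def sum_4 vector_4)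
  then have ne: "v1 \<noteq> v2" using n by auto
  have "independent {v1, v2}"
    using n o by (intro pairwise_orthogonal_independent) (auto simp: pairwise_def orthogonal_def inner_commute)
  then have "dim (span {v1, v2}) = 2"
    using ne by (simp add: dim_eq_card_independent)
  then have "aff_dim (span {v1, v2}) = 2" by (simp add: aff_dim_subspace)
  moreover have "rot_surface b x z ` rot_domain I \<subseteq> span {v1, v2}"
  proof clarify
    fix s t assume "(s, t) \<in> rot_domain I"
    then obtain l where l: "x s = l * x0" "z s = l * z0" using eq by (auto simp: rot_domain_def)
    have "rot_surface b x z (s, t) = (l * cos t) *\<^sub>R v1 + (l * sin t) *\<^sub>R v2"
      using b by (auto simp: rot_surface_def v1_def v2_def vec_eq_iff forall_4 vector_4 l)
    then show "rot_surface b x z (s, t) \<in> span {v1, v2}"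
      by (simp add: span_add span_base span_mul)
  qed
  ultimately show ?thesis
    unfolding planar_def by (intro exI[of _ "span {v1, v2}"]) (simp add: subspace_imp_affine)
qed

section \<open>Constant halves give Gauss maps of the second kind\<close>

context minimal_profile
begin

text \<open>With C = 0, comparing the coefficients of the independent halves makes both factors
  equal to \<open>f\<close>.\<close>

lemma first_kind_imp:
  assumes "first_kind r U" and s: "s \<in> I"
  shows "half_eigenvalue b s = half_eigenvalue (- b) s"
proof -
  have p: "(s, pi) \<in> U" using s by (simp add: rot_domain_def)
  obtain X E f where fr: "adapted_frame r U X E"
    and L: "\<And>p. p \<in> U \<Longrightarrow> laplacian r X E (gauss_map E) p = f p *\<^sub>R (gauss_map E p + 0)"
    using assms(1) unfolding first_kind_def pointwise_1_type_with_def by blast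
  obtain \<sigma> where s1: "\<sigma> \<in> {1, -1 :: real}"
    and s2: "\<forall>p\<in>U. gauss_map E p = \<sigma> *\<^sub>R (nu_minus p + nu_plus p)"
    using gauss_map_eq[OF fr] by blast
  have "(\<sigma> * (half_eigenvalue b s - f (s, pi))) *\<^sub>R nu_minus (s, pi) + (\<sigma> * (half_eigenvalue (- b) s - f (s, pi))) *\<^sub>R nu_plus (s, pi) = 0"
    using L[OF p] unfolding laplacian_gauss_map[OF fr p s2] bspec[OF s2 p] by (simp add: algebra_simps)
  from nu_independent[OF p this] show ?thesis using s1 by auto
qed

text \<open>The sign of the frame is absorbed in \<open>C\<close>, and different factors at one
  point exclude the first kind.\<close>

lemma second_kindI:
  assumes C: "C \<in> bivectors" and f: "smooth_on U f"
    and eq: "\<And>p. p \<in> U \<Longrightarrow> half_eigenvalue b (fst p) *\<^sub>R nu_minus p + half_eigenvalue (- b) (fst p) *\<^sub>R nu_plus p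
       = f p *\<^sub>R (nu_minus p + nu_plus p + C)"
    and s: "s \<in> I" "half_eigenvalue b s \<noteq> half_eigenvalue (- b) s"
  shows "second_kind r U"
proof -
  obtain X E where fr: "adapted_frame r U X E"
    using zmc unfolding zero_mean_curvature_def by blast
  obtain \<sigma> where "\<sigma> \<in> {1, -1 :: real}"
    and s2: "\<forall>p\<in>U. gauss_map E p = \<sigma> *\<^sub>R (nu_minus p + nu_plus p)"
    using gauss_map_eq[OF fr] by blast
  have "laplacian r X E (gauss_map E) p = f p *\<^sub>R (gauss_map E p + \<sigma> *\<^sub>R C)" if "p \<in> U" for p
    unfolding laplacian_gauss_map[OF fr that s2] bspec[OF s2 that] eq[OF that] by (simp add: algebra_simps)
  then have "pointwise_1_type_with r U (\<sigma> *\<^sub>R C)"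
    unfolding pointwise_1_type_with_def using fr f by blast
  then show ?thesis
    unfolding second_kind_def pointwise_1_type_def
    using bivectors_scaleR[OF C] first_kind_imp s by blast
qed

lemma smooth_half_eigenvalue: "smooth_on U (\<lambda>p. half_eigenvalue c (fst p))"
proof -
  note sm = smooth_x smooth_z smooth_on_deriv[OF open_I smooth_x] smooth_on_deriv[OF open_I smooth_z]
  have "smooth_on I (half_eigenvalue c)"
    unfolding half_eigenvalue_def[abs_def] metric_E_def metric_G_def wronskian_def
    by (intro smooth_on_divide smooth_on_mult smooth_on_power smooth_on_diff smooth_on_const sm open_I)
       (use metric_E_nz metric_G_nz in \<open>auto simp: metric_E_def metric_G_def\<close>)
  then show ?thesis unfolding rot_domain_def by (intro smooth_on_fst open_I) auto
qed

lemma half_eigenvalue_eq_0_iff: "s \<in> I \<Longrightarrow> half_eigenvalue c s = 0 \<longleftrightarrow> (1 + c) * wronskian c s = 0"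
  using metric_E_nz metric_G_nz by (auto simp: half_eigenvalue_def)

text \<open>The first order system makes both coefficients constant; moreover either the frequency 1
  + c or the rotating coefficient is zero, so t does not matter either.\<close>

lemma half_map_const:
  assumes c: "c\<^sup>2 = b\<^sup>2" and 0: "\<And>s. s \<in> I \<Longrightarrow> (1 + c) * wronskian c s = 0"
    and p: "p \<in> U" "q \<in> U"
  shows "half_map c J A B p = half_map c J A B q"
proof -
  have s: "fst p \<in> I" "fst q \<in> I" using p by (auto simp: rot_domain_def)
  have P: "(1 + c) * nu_rot c s = 0" if "s \<in> I" for s
    using 0[OF that] by (auto simp: nu_rot_def)
  have "(1 + c) * omega s * nu_const c s * nu_rot c s = 0" "4 * (1 + c) * omega s * (nu_rot c s)\<^sup>2 = 0" if "s \<in> I" for s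
    using P[OF that] by auto
  then have d: "(nu_rot c has_real_derivative 0) (at s)" "(nu_const c has_real_derivative 0) (at s)" if "s \<in> I" for s
    using nu_coefficients_deriv[OF that c] that by metis+
  have "nu_rot c (fst p) = nu_rot c (fst q)" "nu_const c (fst p) = nu_const c (fst q)"
    using has_derivative_zero_interval[OF interval_I d(1)] has_derivative_zero_interval[OF interval_I d(2)] s
    by metis+
  moreover have "nu_rot c (fst q) *\<^sub>R rotating (1 + c) A B (snd p) = nu_rot c (fst q) *\<^sub>R rotating (1 + c) A B (snd q)"
    using P[OF s(2)] by (auto simp: rotating_def)
  ultimately show ?thesis by (simp add: half_map_def)
qed

lemma base_point: obtains s0 where "s0 \<in> I" and "(s0, pi) \<in> U"
  using nonempty_I by (auto simp: rot_domain_def)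

text \<open>The anti-self-dual half is constant, so the Laplacian of the Gauss map is a multiple of
  the Gauss map minus this constant, up to the sign of the frame.\<close>

lemma second_kind_if_minus:
  assumes 0: "\<And>s. s \<in> I \<Longrightarrow> (1 + b) * wronskian b s = 0" and s: "s \<in> I" "half_eigenvalue (- b) s \<noteq> 0"
  shows "second_kind r U"
proof -
  obtain s0 where p0: "(s0, pi) \<in> U" using base_point by blast
  have m: "half_eigenvalue b s = 0" if "s \<in> I" for s using half_eigenvalue_eq_0_iff[OF that] 0[OF that] by simp
  show ?thesis
  proof (rule second_kindI[OF bivectors_uminus[OF nu_bivectors(1)[of "(s0, pi)"]] smooth_half_eigenvalue[of "- b"] _ s(1)])
    fix p assume p: "p \<in> U"
    then have "half_eigenvalue b (fst p) = 0" using m by (auto simp: rot_domain_def)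
    moreover have "nu_minus (s0, pi) = nu_minus p"
      unfolding nu_minus_def by (rule half_map_const[OF refl 0 p0 p])
    ultimately show "half_eigenvalue b (fst p) *\<^sub>R nu_minus p + half_eigenvalue (- b) (fst p) *\<^sub>R nu_plus p
       = half_eigenvalue (- b) (fst p) *\<^sub>R (nu_minus p + nu_plus p + - nu_minus (s0, pi))" by simp
  qed (use m s in simp)
qed

text \<open>The mirror image for the self-dual half; for b = 1 the factor 1 + - b already
  vanishes.\<close>

lemma second_kind_if_plus:
  assumes 0: "\<And>s. s \<in> I \<Longrightarrow> (1 + - b) * wronskian (- b) s = 0" and s: "s \<in> I" "half_eigenvalue b s \<noteq> 0"
  shows "second_kind r U"
proof -
  obtain s0 where p0: "(s0, pi) \<in> U" using base_point by blast
  have m: "half_eigenvalue (- b) s = 0" if "s \<in> I" for s using half_eigenvalue_eq_0_iff[OF that] 0[OF that] by simp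
  show ?thesis
  proof (rule second_kindI[OF bivectors_uminus[OF nu_bivectors(2)[of "(s0, pi)"]] smooth_half_eigenvalue[of b] _ s(1)])
    fix p assume p: "p \<in> U"
    then have "half_eigenvalue (- b) (fst p) = 0" using m by (auto simp: rot_domain_def)
    moreover have "nu_plus (s0, pi) = nu_plus p"
      unfolding nu_plus_def by (rule half_map_const[OF _ 0 p0 p]) simp_all
    ultimately show "half_eigenvalue b (fst p) *\<^sub>R nu_minus p + half_eigenvalue (- b) (fst p) *\<^sub>R nu_plus p
       = half_eigenvalue b (fst p) *\<^sub>R (nu_minus p + nu_plus p + - nu_plus (s0, pi))" by simp
  qed (use m s in simp)
qed

lemma planar_if_wronskian_zero:
  assumes b: "b = 1" and 0: "\<And>s. s \<in> I \<Longrightarrow> wronskian b s = 0"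
  shows "planar r U"
proof -
  obtain s0 where s0: "s0 \<in> I" using base_point by blast
  \<comment> \<open>x or z may have zeros, so quotients are avoided: \<open>u\<close> measures the
    deviation from the direction of the base point. It satisfies 2 u' G = u G', so u^2 / G is
    constant, and it is 0 at \<open>s0\<close>.\<close>
  define u where "u s = x s0 * z s - z s0 * x s" for s
  have G: "metric_G s \<noteq> 0" if "s \<in> I" for s using metric_G_nz that .
  have "((\<lambda>s. (u s)\<^sup>2 / metric_G s) has_real_derivative 0) (at s)" if s: "s \<in> I" for s
  proof -
    note d = profile_derivs[OF s]
    define u1 where "u1 = x s0 * z1 s - z s0 * x1 s"
    define G1 where "G1 = 2 * (x s * x1 s - z s * z1 s)"
    have du: "(u has_real_derivative u1) (at s)"
      unfolding u_def[abs_def] u1_def by (rule derivative_eq_intros d refl)+ simp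
    have dG: "(metric_G has_real_derivative G1) (at s)"
      unfolding metric_G_def[abs_def] G1_def by (rule derivative_eq_intros d refl)+ (simp add: b)
    have "2 * u1 * metric_G s = u s * G1"
    proof -
      have "x s * z1 s - z s * x1 s = 0" and m: "metric_G s = (x s)\<^sup>2 - (z s)\<^sup>2"
        using 0[OF s] metric_G_def[of s] by (simp_all add: wronskian_def b)
      then show ?thesis unfolding u1_def G1_def u_def m by algebra
    qed
    then have e: "(2 * u s * u1) * metric_G s - (u s)\<^sup>2 * G1 = 0" by algebra
    have "((\<lambda>s. (u s)\<^sup>2 / metric_G s) has_real_derivative ((2 * u s * u1) * metric_G s - (u s)\<^sup>2 * G1) / (metric_G s * metric_G s)) (at s)"
      by (rule derivative_eq_intros du dG refl G s)+ simp
    then show ?thesis unfolding e by simp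
  qed
  from has_derivative_zero_interval[OF interval_I this]
  have "(u s)\<^sup>2 / metric_G s = (u s0)\<^sup>2 / metric_G s0" if "s \<in> I" for s using that s0 by metis
  then have u: "x s0 * z s = z s0 * x s" if "s \<in> I" for s
    using that G[OF that] unfolding u_def by force
  have nz: "x s0 \<noteq> 0 \<or> z s0 \<noteq> 0" using G[OF s0] by (auto simp: metric_G_def)
  have "\<exists>l. x s = l * x s0 \<and> z s = l * z s0" if "s \<in> I" for s
  proof (cases "x s0 = 0")
    case True
    then show ?thesis using u[OF that] nz by (intro exI[of _ "z s / z s0"]) auto
  next
    case False
    then show ?thesis using u[OF that] by (intro exI[of _ "x s / x s0"]) (auto simp: field_simps)
  qed
  from planarI[OF nz _ this] b show ?thesis by simp
qed

section \<open>Necessity in the spacelike case\<close>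

lemma spacelike_pos:
  assumes "spacelike r U" and s: "s \<in> I"
  shows "metric_E s > 0" and "metric_G s > 0"
proof -
  have p: "(s, pi) \<in> U" using s by (simp add: rot_domain_def)
  obtain rst where rj: "second_order_jet U r rs rt rss rst rtt" using surface_jet by blast
  have pos: "ip (fst v *\<^sub>R rs (s, pi) + snd v *\<^sub>R rt (s, pi)) (fst v *\<^sub>R rs (s, pi) + snd v *\<^sub>R rt (s, pi)) > 0"
    if "v \<noteq> 0" for v :: "real \<times> real"
    using assms(1)[unfolded spacelike_def, rule_format, OF p that]
    unfolding deriv_along_jet[OF rj p, of "\<lambda>_. v", unfolded deriv_along_def] .
  show "metric_E s > 0" and "metric_G s > 0"
    using pos[of "(1, 0)"] pos[of "(0, 1)"] by (simp_all add: ip_tangent zero_prod_def)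
qed

text \<open>\<open>nu_rot\<close> is a positive multiple of the Wronskian and solves a homogeneous
  linear equation with continuous coefficient.\<close>

lemma wronskian_zero_or_nonzero:
  assumes c: "c\<^sup>2 = b\<^sup>2" and "s \<in> I" "s' \<in> I" and "wronskian c s = 0"
  shows "wronskian c s' = 0"
proof -
  have "continuous_on I (\<lambda>s. (1 + c) * omega s * nu_const c s)"
    using omega_deriv nu_coefficients_deriv(2)[OF _ c]
    by (intro continuous_intros continuous_at_imp_continuous_on ballI) (auto intro: DERIV_isCont)
  then have "nu_rot c s' = 0"
    using linear_ode_zero[OF interval_I nu_coefficients_deriv(1)[OF _ c] _ assms(2,3)] assms(4) by (auto simp: nu_rot_def)
  then show ?thesis using nu_scale_pos[OF assms(3)] by (simp add: nu_rot_def)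
qed

text \<open>Otherwise neither Wronskian has a zero. For one fixed s both halves then rotate with t,
  and \<open>half_rigid\<close> makes every component of C vanish, which would be the first
  kind.\<close>

lemma second_kind_imp:
  assumes sk: "second_kind r U" and b: "b > 0" "b \<noteq> 1" and sp: "spacelike r U"
  shows "(\<forall>s\<in>I. wronskian b s = 0) \<or> (\<forall>s\<in>I. wronskian (- b) s = 0)"
proof (rule ccontr)
  assume "\<not> ?thesis"
  then obtain s1 s2 where "s1 \<in> I" "wronskian b s1 \<noteq> 0" "s2 \<in> I" "wronskian (- b) s2 \<noteq> 0" by auto
  then have pnz: "wronskian b s \<noteq> 0" "wronskian (- b) s \<noteq> 0" if "s \<in> I" for s
    using wronskian_zero_or_nonzero[of b s] wronskian_zero_or_nonzero[of "- b" s] that by auto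
  obtain s where s: "s \<in> I" using base_point by blast
  have "metric_E s > 0" "metric_G s > 0" using spacelike_pos[OF sp s] .
  then have metric_sign: "metric_sign s > 0" using nu_scale_pos[OF s] by (simp add: metric_sign_def)
  \<comment> \<open>For a spacelike surface the square of \<open>nu_const\<close> is 1 plus a
    square; this keeps the fixed component nonzero.\<close>
  have D: "nu_const c s \<noteq> 0" if "c\<^sup>2 = b\<^sup>2" for c
    using nu_coefficients_quadric[OF that, of s] metric_sign by (metis add_pos_nonneg less_numeral_extra(3) mult_nonneg_nonneg
        power_zero_numeral zero_le_numeral zero_le_power2)
  have P: "nu_rot b s \<noteq> 0" "nu_rot (- b) s \<noteq> 0" using pnz[OF s] nu_scale_pos[OF s] by (auto simp: nu_rot_def)
  have m: "half_eigenvalue b s \<noteq> 0" "half_eigenvalue (- b) s \<noteq> 0" using half_eigenvalue_eq_0_iff[OF s] pnz[OF s] b by auto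
  obtain C X E f where C: "C \<in> bivectors" and pt: "pointwise_1_type_with r U C" and fr: "adapted_frame r U X E"
    and L: "\<And>p. p \<in> U \<Longrightarrow> laplacian r X E (gauss_map E) p = f p *\<^sub>R (gauss_map E p + C)"
    using sk unfolding second_kind_def pointwise_1_type_def pointwise_1_type_with_def by blast
  obtain \<sigma> where s1: "\<sigma> \<in> {1, -1 :: real}"
    and s2: "\<forall>p\<in>U. gauss_map E p = \<sigma> *\<^sub>R (nu_minus p + nu_plus p)"
    using gauss_map_eq[OF fr] by blast
  have comp: "\<sigma> * (half_eigenvalue b s * nu_minus (s, t) $ i $ j + half_eigenvalue (- b) s * nu_plus (s, t) $ i $ j)
      = f (s, t) * (\<sigma> * (nu_minus (s, t) $ i $ j + nu_plus (s, t) $ i $ j) + C $ i $ j)"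
    if "t \<in> {0<..<2 * pi}" for t i j
  proof -
    have p: "(s, t) \<in> U" using s that by (simp add: rot_domain_def)
    have "(\<sigma> *\<^sub>R (half_eigenvalue b s *\<^sub>R nu_minus (s, t) + half_eigenvalue (- b) s *\<^sub>R nu_plus (s, t))) $ i $ j
      = (f (s, t) *\<^sub>R (\<sigma> *\<^sub>R (nu_minus (s, t) + nu_plus (s, t)) + C)) $ i $ j"
      using L[OF p] unfolding laplacian_gauss_map[OF fr p s2] bspec[OF s2 p] by simp
    then show ?thesis by simp
  qed
  have \<sigma>: "\<sigma> \<noteq> 0" using s1 by auto
  note nth = nu_minus_nth nu_plus_nth fst_conv snd_conv
  \<comment> \<open>In these three combinations of components \<open>nu_plus\<close> drops out,
    which leaves the equation of the anti-self-dual half.\<close>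
  have "C $ 1 $ 2 - C $ 3 $ 4 = 0" "C $ 1 $ 4 + C $ 2 $ 3 = 0" "C $ 2 $ 4 - C $ 1 $ 3 = 0"
  proof -
    have nz: "\<sigma> * nu_const b s \<noteq> 0" "2 * \<sigma> * nu_rot b s \<noteq> 0" "1 + b \<noteq> 0" using \<sigma> D P b by auto
    have "half_eigenvalue b s * (\<sigma> * nu_const b s) = f (s, t) * (\<sigma> * nu_const b s + (C $ 1 $ 2 - C $ 3 $ 4))"
      "half_eigenvalue b s * (2 * \<sigma> * nu_rot b s * cos ((1 + b) * t)) = f (s, t) * (2 * \<sigma> * nu_rot b s * cos ((1 + b) * t) + (C $ 1 $ 4 + C $ 2 $ 3))"
      "half_eigenvalue b s * (2 * \<sigma> * nu_rot b s * sin ((1 + b) * t)) = f (s, t) * (2 * \<sigma> * nu_rot b s * sin ((1 + b) * t) + (C $ 2 $ 4 - C $ 1 $ 3))"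
      if "t \<in> {0<..<2 * pi}" for t
      using comp[OF that, of 1 2] comp[OF that, of 3 4] comp[OF that, of 1 4] comp[OF that, of 2 3]
        comp[OF that, of 2 4] comp[OF that, of 1 3] unfolding nth
      by (simp_all add: algebra_simps)
    from half_rigid[OF m(1) nz this]
    show "C $ 1 $ 2 - C $ 3 $ 4 = 0" "C $ 1 $ 4 + C $ 2 $ 3 = 0" "C $ 2 $ 4 - C $ 1 $ 3 = 0" by auto
  qed
  \<comment> \<open>The complementary combinations isolate the self-dual half; its frequency 1 - b
    is nonzero as b differs from 1.\<close>
  moreover have "C $ 1 $ 2 + C $ 3 $ 4 = 0" "C $ 1 $ 4 - C $ 2 $ 3 = 0" "C $ 2 $ 4 + C $ 1 $ 3 = 0"
  proof -
    have nz: "- \<sigma> * nu_const (- b) s \<noteq> 0" "2 * \<sigma> * nu_rot (- b) s \<noteq> 0" "1 - b \<noteq> 0" using \<sigma> D[of "- b"] P b by auto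
    have "half_eigenvalue (- b) s * (- \<sigma> * nu_const (- b) s) = f (s, t) * (- \<sigma> * nu_const (- b) s + (C $ 1 $ 2 + C $ 3 $ 4))"
      "half_eigenvalue (- b) s * (2 * \<sigma> * nu_rot (- b) s * cos ((1 - b) * t)) = f (s, t) * (2 * \<sigma> * nu_rot (- b) s * cos ((1 - b) * t) + (C $ 1 $ 4 - C $ 2 $ 3))"
      "half_eigenvalue (- b) s * (2 * \<sigma> * nu_rot (- b) s * sin ((1 - b) * t)) = f (s, t) * (2 * \<sigma> * nu_rot (- b) s * sin ((1 - b) * t) + (C $ 2 $ 4 + C $ 1 $ 3))"
      if "t \<in> {0<..<2 * pi}" for t
      using comp[OF that, of 1 2] comp[OF that, of 3 4] comp[OF that, of 1 4] comp[OF that, of 2 3]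
        comp[OF that, of 2 4] comp[OF that, of 1 3] unfolding nth
      by (simp_all add: algebra_simps)
    from half_rigid[OF m(2) nz this]
    show "C $ 1 $ 2 + C $ 3 $ 4 = 0" "C $ 1 $ 4 - C $ 2 $ 3 = 0" "C $ 2 $ 4 + C $ 1 $ 3 = 0" by auto
  qed
  ultimately have "C = 0" by (intro bivectors_eq_0[OF C]) auto
  then show False using pt sk unfolding second_kind_def first_kind_def by simp
qed

section \<open>Wronskians of the power profiles\<close>

lemma wronskian_power_profile:
  assumes x: "\<And>s. s \<in> I \<Longrightarrow> x s \<noteq> 0" and z: "\<And>s. s \<in> I \<Longrightarrow> z s = b0 * \<bar>x s\<bar> powr a" and s: "s \<in> I"
  shows "wronskian a s = 0"
proof -
  have "((\<lambda>s. b0 * \<bar>x s\<bar> powr a) has_real_derivative b0 * (a * \<bar>x s\<bar> powr a * (x1 s / x s))) (at s)"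
    by (intro DERIV_cmult abs_powr_has_real_derivative profile_derivs s x)
  then have "(z has_real_derivative b0 * (a * \<bar>x s\<bar> powr a * (x1 s / x s))) (at s)"
    by (rule has_field_derivative_transform_within_open[OF _ open_I s]) (simp add: z)
  then have "z1 s = b0 * (a * \<bar>x s\<bar> powr a * (x1 s / x s))"
    using profile_derivs(2)[OF s] DERIV_unique by blast
  then show ?thesis using x[OF s] unfolding wronskian_def z[OF s] by simp
qed

text \<open>Sum and difference of the two Wronskians give x z' = 0 and b z x' = 0, hence x' = z' =
  0, against regularity.\<close>

lemma wronskians_not_both_zero:
  assumes "s \<in> I" and "b \<noteq> 0" "x s \<noteq> 0" "z s \<noteq> 0"
  shows "wronskian b s \<noteq> 0 \<or> wronskian (- b) s \<noteq> 0"
proof (rule ccontr)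
  assume "\<not> ?thesis"
  then have "wronskian b s = 0" "wronskian (- b) s = 0" by auto
  then have "2 * (x s * z1 s) = 0" "2 * (b * z s * x1 s) = 0" unfolding wronskian_def by algebra+
  then have "metric_E s = 0" using assms by (simp add: metric_E_def)
  then show False using metric_E_nz[OF assms(1)] by simp
qed

end

theorem theorem4p2:
  fixes b :: real and I :: "real set" and x z :: "real \<Rightarrow> real"
  assumes "b > 0"
    and "open I" and "is_interval I" and "I \<noteq> {}"
    and "smooth_on I x" and "smooth_on I z"
    and "regular_profile b I x z"
    and "\<not> planar (rot_surface b x z) (rot_domain I)"
    and "zero_mean_curvature (rot_surface b x z) (rot_domain I)"
  shows
    "(b = 1 \<and> (\<exists>l0 m0. l0 \<noteq> 0 \<and> (\<forall>s\<in>I. (x s + z s)\<^sup>2 + l0 * (x s - z s)\<^sup>2 = m0))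
        \<longrightarrow> second_kind (rot_surface b x z) (rot_domain I)) \<and>
     (b \<noteq> 1 \<and> spacelike (rot_surface b x z) (rot_domain I) \<longrightarrow>
        (second_kind (rot_surface b x z) (rot_domain I) \<longleftrightarrow>
          (\<exists>b0. b0 \<noteq> 0 \<and>
             ((\<forall>s\<in>I. z s = b0 * \<bar>x s\<bar> powr b) \<or> (\<forall>s\<in>I. z s = b0 * \<bar>x s\<bar> powr (- b))))))"
proof -
  interpret minimal_profile b I x z
    using assms by unfold_locales
  \<comment> \<open>For b = 1 the self-dual half does not rotate and is constant; non-planarity
    provides a point where the factor of the other half is nonzero.\<close>
  have "second_kind r U" if "b = 1"
  proof -
    obtain s where "s \<in> I" "wronskian b s \<noteq> 0"
      using planar_if_wronskian_zero[OF \<open>b = 1\<close>] assms(8) by blast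
    then show ?thesis
      using that half_eigenvalue_eq_0_iff[of s b] by (intro second_kind_if_plus[of s]) simp_all
  qed
  moreover have "second_kind r U \<longleftrightarrow> (\<exists>b0. b0 \<noteq> 0 \<and>
             ((\<forall>s\<in>I. z s = b0 * \<bar>x s\<bar> powr b) \<or> (\<forall>s\<in>I. z s = b0 * \<bar>x s\<bar> powr (- b))))"
    if b: "b \<noteq> 1" and sp: "spacelike r U"
  proof
    \<comment> \<open>From x^2 > b^2 z^2; powers of |x| are therefore differentiable along the
      profile.\<close>
    have xnz: "x s \<noteq> 0" if "s \<in> I" for s
    proof -
      have "0 < (x s)\<^sup>2 - (b * z s)\<^sup>2"
        using spacelike_pos(2)[OF sp that] by (simp add: metric_G_def power_mult_distrib)
      moreover have "0 \<le> (b * z s)\<^sup>2" by simp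
      ultimately have "0 < (x s)\<^sup>2" by linarith
      then show ?thesis by simp
    qed
    have prof: "\<exists>b0. b0 \<noteq> 0 \<and> (\<forall>s\<in>I. z s = b0 * \<bar>x s\<bar> powr c)" if "\<forall>s\<in>I. wronskian c s = 0" for c
    proof -
      obtain b0 where b0: "\<forall>s\<in>I. z s = b0 * \<bar>x s\<bar> powr c"
        using power_curve[OF interval_I xnz profile_derivs(1,2), of c] \<open>\<forall>s\<in>I. wronskian c s = 0\<close>
        by (auto simp: wronskian_def)
      \<comment> \<open>With b0 = 0 the surface would lie in the first rotation plane.\<close>
      have "b0 \<noteq> 0"
      proof
        assume "b0 = 0"
        then have "planar r U" using b0 by (intro planarI[of 1 0]) auto
        then show False using assms(8) by simp
      qed
      then show ?thesis using b0 by blast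
    qed
    show "\<exists>b0. b0 \<noteq> 0 \<and> ((\<forall>s\<in>I. z s = b0 * \<bar>x s\<bar> powr b) \<or> (\<forall>s\<in>I. z s = b0 * \<bar>x s\<bar> powr (- b)))"
      if "second_kind r U"
      using second_kind_imp[OF that assms(1) b sp] prof by blast
    show "second_kind r U"
      if ex: "\<exists>b0. b0 \<noteq> 0 \<and> ((\<forall>s\<in>I. z s = b0 * \<bar>x s\<bar> powr b) \<or> (\<forall>s\<in>I. z s = b0 * \<bar>x s\<bar> powr (- b)))"
    proof -
      obtain b0 where b0: "b0 \<noteq> 0" and
        or: "(\<forall>s\<in>I. z s = b0 * \<bar>x s\<bar> powr b) \<or> (\<forall>s\<in>I. z s = b0 * \<bar>x s\<bar> powr (- b))"
        using ex by blast
      obtain s where s: "s \<in> I" using base_point by blast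
      have "z s \<noteq> 0" using or b0 xnz[OF s] s by auto
      \<comment> \<open>As one Wronskian vanishes for the given profile, the other does not vanish
        at \<open>s\<close>; so exactly one half is constant and the first kind is excluded.\<close>
      then have nz: "wronskian b s \<noteq> 0 \<or> wronskian (- b) s \<noteq> 0" using wronskians_not_both_zero[OF s _ xnz[OF s]] assms(1) by simp
      from or show ?thesis
      proof
        assume "\<forall>s\<in>I. z s = b0 * \<bar>x s\<bar> powr b"
        then have 0: "wronskian b s = 0" if "s \<in> I" for s using wronskian_power_profile[OF xnz _ that] by blast
        then show ?thesis
          using nz s b half_eigenvalue_eq_0_iff[OF s, of "- b"] by (intro second_kind_if_minus[of s]) auto
      next
        assume "\<forall>s\<in>I. z s = b0 * \<bar>x s\<bar> powr (- b)"
        then have 0: "wronskian (- b) s = 0" if "s \<in> I" for s using wronskian_power_profile[OF xnz _ that] by blast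
        then show ?thesis
          using nz s assms(1) half_eigenvalue_eq_0_iff[OF s, of b] by (intro second_kind_if_plus[of s]) auto
      qed
    qed
  qed
  ultimately show ?thesis by blast
qed

end
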